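(* Let $E$ be a finite set of items with random realization $\Phi\sim p$, let $M\subseteq G$ be a set of $m$ training tasks, let $l,k$ be integers with $l>1$ and $k-l>1$, and suppose that the (not necessarily monotone) non-negative utility function $f^i$ is adaptive submodular for every task $i\in M$. Let $\pi^{r}$ be the two-phase randomized greedy policy with parameters $l,k$, and let $\pi^{o}$ be an optimal policy for the adaptive submodular meta-learning problem $\max_{S\subseteq E,\,|S|=l}\ \max_{\pi\in\Omega(S,k)} f_{avg}(\pi)$. Then $\pi^r$ achieves a $1/32$ approximation ratio, i.e. $$f_{avg}(\pi^{r})\ \ge\ \tfrac1{32}\, f_{avg}(\pi^{o}).$$
   Context: Items and states. $E$ is a finite set of $n$ items and $O$ a set of states. A realization is a function $\phi:E\to O$; $\Phi$ denotes the random realization, distributed according to a known (discrete) prior $p$. A partial realization $\psi$ is a function from a subset $\mathrm{dom}(\psi)\subseteq E$ to $O$; $\Phi\sim\psi$ means that $\Phi$ agrees with $\psi$ on $\mathrm{dom}(\psi)$; $\psi\subseteq\psi'$ means $\mathrm{dom}(\psi)\subseteq\mathrm{dom}(\psi')$ and the two agree on $\mathrm{dom}(\psi)$. Only partial realizations with $\Pr[\Phi\sim\psi]>0$ are considered. An item's state is observed only upon selecting it. Tasks. $G$ is a family of tasks; each $i\in G$ has a utility function $f^i:2^E\times O^E\to\mathbb{R}_{\ge 0}$. $M\subseteq G$ is a set of $m$ training tasks. All expectations appearing are assumed finite. For $Y\subseteq E$, $f^i(Y)=\mathbb{E}_{\Phi\sim p}[f^i(Y,\Phi)]$. The conditional expected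 marginal utility is $\Delta_i(e\mid\psi)=\mathbb{E}[f^i(\mathrm{dom}(\psi)\cup\{e\},\Phi)-f^i(\mathrm{dom}(\psi),\Phi)\mid\Phi\sim\psi]$. $f^i$ is adaptive submodular if $\Delta_i(e\mid\psi)\ge\Delta_i(e\mid\psi')$ for all $\psi\subseteq\psi'$ and $e\in E\setminus\mathrm{dom}(\psi')$. Policies. A (possibly randomized) adaptive policy $\pi$ chooses the next item to select (or stops) based on the current task and the partial realization observed so far. $E(\pi,\phi,i)$ is the (random) set of items it selects under realization $\phi$ for task $i$. $f^i_{avg}(\pi)=\mathbb{E}[f^i(E(\pi,\Phi,i),\Phi)]$, the expectation being over $\Phi\sim p$ and the internal randomness of $\pi$ (independent of $\Phi$), and $f_{avg}(\pi)=\frac1m\sum_{i\in M}f^i_{avg}(\pi)$. $\Omega(S,k)$ is the set of policies that, for every task, first select all items of $S$ (the same $S$ for all tasks), then may adaptively select further items depending on the task and observed states, with $|E(\pi,\phi,i)|\le k$ for all $\phi$ with $p(\phi)>0$. Two-phase randomized greedy policy $\pi^r$. Add a set $D$ of $k$ dummy items, each of which always has zero marginal utility (so they may be removed from any set without changing its utility); let $E'=E\cup D$. Initialization: start with $S^r=\emptyset$; in each of $l$ rounds, let $U(S^r)\subseteq E'$ be a set of $l$ items with the largest values of $\frac1m\sum_{i\in M}(f^i(S^r\cup\{e\})-f^i(S^r))$, and add to $S^r$ an item sampled uniformly at random from $U(S^r)$. Execution for an incoming task $i$: select all of $S^r$ and observe their states, giving $\psi^{r_l}$; then in each of the $k-l$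 rounds $t=l+1,\dots,k$ let $U(\psi^{r_{t-1}})\subseteq E'$ be a set of $k-l$ items with the largest values of $\Delta_i(e\mid\psi^{r_{t-1}})$, select an item $e_t$ sampled uniformly at random from $U(\psi^{r_{t-1}})$, observe its state, and set $\psi^{r_t}=\psi^{r_{t-1}}\cup\{\phi(e_t)\}$. Ties are broken arbitrarily. *)

theory Defs
  imports "HOL-Probability.Probability"
begin

type_synonym ('e, 's) realization = "'e \<Rightarrow> 's"

type_synonym ('e, 's) partial_realization = "'e \<rightharpoonup> 's"

type_synonym ('g, 'e, 's) utility = "'g \<Rightarrow> 'e set \<Rightarrow> ('e, 's) realization \<Rightarrow> real"

definition agrees :: "('e, 's) realization \<Rightarrow> ('e, 's) partial_realization \<Rightarrow> bool" where
  "agrees \<phi> \<psi> \<longleftrightarrow> \<psi> \<subseteq>\<^sub>m (\<lambda>e. Some (\<phi> e))"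

definition observe :: "('e, 's) realization \<Rightarrow> 'e set \<Rightarrow> ('e, 's) partial_realization" where
  "observe \<phi> Y = (\<lambda>e. Some (\<phi> e)) |` Y"

text \<open>The partial realizations that are considered: those of positive probability.\<close>

definition partial_realizations ::
  "'e set \<Rightarrow> ('e, 's) realization pmf \<Rightarrow> ('e, 's) partial_realization set" where
  "partial_realizations E p =
     {\<psi>. dom \<psi> \<subseteq> E \<and> measure_pmf.prob p {\<phi>. agrees \<phi> \<psi>} > 0}"

definition expected_utility ::
  "('e, 's) realization pmf \<Rightarrow> ('g, 'e, 's) utility \<Rightarrow> 'g \<Rightarrow> 'e set \<Rightarrow> real" where
  "expected_utility p f i Y = measure_pmf.expectation p (\<lambda>\<phi>. f i Y \<phi>)"

definition cond_marginal ::
  "('e, 's) realization pmf \<Rightarrow> ('g, 'e, 's) utility \<Rightarrow> 'g \<Rightarrow> 'e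
    \<Rightarrow> ('e, 's) partial_realization \<Rightarrow> real" where
  "cond_marginal p f i e \<psi> =
     measure_pmf.expectation (cond_pmf p {\<phi>. agrees \<phi> \<psi>})
       (\<lambda>\<phi>. f i (dom \<psi> \<union> {e}) \<phi> - f i (dom \<psi>) \<phi>)"

definition adaptive_submodular ::
  "'e set \<Rightarrow> ('e, 's) realization pmf \<Rightarrow> ('g, 'e, 's) utility \<Rightarrow> 'g \<Rightarrow> bool" where
  "adaptive_submodular E p f i \<longleftrightarrow>
     (\<forall>\<psi> \<in> partial_realizations E p. \<forall>\<psi>' \<in> partial_realizations E p. \<psi> \<subseteq>\<^sub>m \<psi>' \<longrightarrow>
        (\<forall>e \<in> E - dom \<psi>'. cond_marginal p f i e \<psi>' \<le> cond_marginal p f i e \<psi>))"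

text \<open>
  A policy maps the task and the current partial realization to a distribution over the next
  item, where \<^const>\<open>None\<close> means stopping.  All random choices are made by these
  distributions, independently of the realization.
\<close>

type_synonym ('g, 'e, 's) policy = "'g \<Rightarrow> ('e, 's) partial_realization \<Rightarrow> 'e option pmf"

definition policies ::
  "'e set \<Rightarrow> ('e, 's) realization pmf \<Rightarrow> 'g set \<Rightarrow> ('g, 'e, 's) policy set" where
  "policies E p G =
     {\<pi>. \<forall>i \<in> G. \<forall>\<psi> \<in> partial_realizations E p.
           set_pmf (\<pi> i \<psi>) \<subseteq> insert None (Some ` (E - dom \<psi>))}"

text \<open>\<open>run \<pi> i \<phi> n Y\<close>: continue from the already selected set \<open>Y\<close> for at most \<open>n\<close> further items.\<close>

fun run :: "('g, 'e, 's) policy \<Rightarrow> 'g \<Rightarrow> ('e, 's) realization \<Rightarrow> nat \<Rightarrow> 'e set \<Rightarrow> 'e set pmf" where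
  "run \<pi> i \<phi> 0 Y = return_pmf Y"
| "run \<pi> i \<phi> (Suc n) Y =
     bind_pmf (\<pi> i (observe \<phi> Y))
       (\<lambda>c. case c of None \<Rightarrow> return_pmf Y | Some e \<Rightarrow> run \<pi> i \<phi> n (insert e Y))"

text \<open>
  The random set of items selected under \<open>\<phi>\<close> for task \<open>i\<close>.  Each step selects a new item of
  \<open>E\<close>, so \<^term>\<open>card E\<close> steps exhaust every policy.
\<close>

definition selected ::
  "'e set \<Rightarrow> ('g, 'e, 's) policy \<Rightarrow> 'g \<Rightarrow> ('e, 's) realization \<Rightarrow> 'e set pmf" where
  "selected E \<pi> i \<phi> = run \<pi> i \<phi> (card E) {}"

text \<open>
  The average utility over the training tasks, as a function of the distribution \<open>sel i \<phi>\<close> of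
  the set selected for task \<open>i\<close> under \<open>\<phi>\<close>.
\<close>

definition f_avg_task ::
  "('e, 's) realization pmf \<Rightarrow> ('g, 'e, 's) utility
    \<Rightarrow> ('g \<Rightarrow> ('e, 's) realization \<Rightarrow> 'e set pmf) \<Rightarrow> 'g \<Rightarrow> real" where
  "f_avg_task p f sel i =
     measure_pmf.expectation p (\<lambda>\<phi>. measure_pmf.expectation (sel i \<phi>) (\<lambda>Y. f i Y \<phi>))"

definition f_avg ::
  "('e, 's) realization pmf \<Rightarrow> ('g, 'e, 's) utility \<Rightarrow> 'g set
    \<Rightarrow> ('g \<Rightarrow> ('e, 's) realization \<Rightarrow> 'e set pmf) \<Rightarrow> real" where
  "f_avg p f M sel = 1 / real (card M) * (\<Sum>i\<in>M. f_avg_task p f sel i)"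

text \<open>
  The first conjunct of the inner condition says that the first \<^term>\<open>card S\<close> items selected
  are exactly those of \<open>S\<close>.
\<close>

definition Omega_policies ::
  "'e set \<Rightarrow> ('e, 's) realization pmf \<Rightarrow> 'g set \<Rightarrow> 'e set \<Rightarrow> nat \<Rightarrow> ('g, 'e, 's) policy set" where
  "Omega_policies E p G S k =
     {\<pi> \<in> policies E p G. \<forall>i \<in> G. \<forall>\<phi> \<in> set_pmf p.
        run \<pi> i \<phi> (card S) {} = return_pmf S \<and>
        (\<forall>Y \<in> set_pmf (selected E \<pi> i \<phi>). card Y \<le> k)}"

definition optimal_policy ::
  "'e set \<Rightarrow> ('e, 's) realization pmf \<Rightarrow> ('g, 'e, 's) utility \<Rightarrow> 'g set \<Rightarrow> 'g set
    \<Rightarrow> nat \<Rightarrow> nat \<Rightarrow> ('g, 'e, 's) policy \<Rightarrow> bool" where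
  "optimal_policy E p f G M l k \<pi> \<longleftrightarrow>
     (\<exists>S. S \<subseteq> E \<and> card S = l \<and> \<pi> \<in> Omega_policies E p G S k) \<and>
     (\<forall>S \<pi>'. S \<subseteq> E \<and> card S = l \<and> \<pi>' \<in> Omega_policies E p G S k \<longrightarrow>
        f_avg p f M (selected E \<pi>') \<le> f_avg p f M (selected E \<pi>))"

text \<open>
  The items \<open>E'\<close>: \<^term>\<open>Inl e\<close> is the item \<open>e\<close> and \<^term>\<open>Inr j\<close>, for \<open>j < k\<close>, is a dummy.
  Dummies have no state and are removed before a utility is evaluated.
\<close>

definition extended_items :: "'e set \<Rightarrow> nat \<Rightarrow> ('e + nat) set" where
  "extended_items E k = E <+> {..<k}"

definition real_items :: "('e + nat) set \<Rightarrow> 'e set" where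
  "real_items S = {e. Inl e \<in> S}"

definition top_set :: "'a set \<Rightarrow> nat \<Rightarrow> ('a \<Rightarrow> real) \<Rightarrow> 'a set \<Rightarrow> bool" where
  "top_set A r g U \<longleftrightarrow> U \<subseteq> A \<and> card U = r \<and> (\<forall>x \<in> U. \<forall>y \<in> A - U. g y \<le> g x)"

definition initial_marginal ::
  "('e, 's) realization pmf \<Rightarrow> ('g, 'e, 's) utility \<Rightarrow> 'g set
    \<Rightarrow> ('e + nat) set \<Rightarrow> 'e + nat \<Rightarrow> real" where
  "initial_marginal p f M S e =
     1 / real (card M) *
       (\<Sum>i\<in>M. expected_utility p f i (real_items (S \<union> {e})) - expected_utility p f i (real_items S))"

fun extended_marginal ::
  "('e, 's) realization pmf \<Rightarrow> ('g, 'e, 's) utility \<Rightarrow> 'g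
    \<Rightarrow> ('e, 's) partial_realization \<Rightarrow> 'e + nat \<Rightarrow> real" where
  "extended_marginal p f i \<psi> (Inl e) = cond_marginal p f i e \<psi>"
| "extended_marginal p f i \<psi> (Inr d) = 0"

text \<open>
  The greedy policy depends on how ties are broken, which is described by rules \<open>U1\<close>
  (initialization) and \<open>U2\<close> (execution) returning the set to sample from.  A rule may use the
  whole list \<open>h\<close> of items chosen so far (latest first) and, for \<open>U2\<close>, the task and the observed
  states.  A list may contain repetitions: choosing an item again has no effect, as with a dummy.
\<close>

definition initial_rule ::
  "'e set \<Rightarrow> ('e, 's) realization pmf \<Rightarrow> ('g, 'e, 's) utility \<Rightarrow> 'g set \<Rightarrow> nat \<Rightarrow> nat
    \<Rightarrow> (('e + nat) list \<Rightarrow> ('e + nat) set) \<Rightarrow> bool" where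
  "initial_rule E p f M l k U1 \<longleftrightarrow>
     (\<forall>h. set h \<subseteq> extended_items E k \<and> length h < l \<longrightarrow>
        top_set (extended_items E k) l (initial_marginal p f M (set h)) (U1 h))"

definition execution_rule ::
  "'e set \<Rightarrow> ('e, 's) realization pmf \<Rightarrow> ('g, 'e, 's) utility \<Rightarrow> 'g set \<Rightarrow> nat \<Rightarrow> nat
    \<Rightarrow> ('g \<Rightarrow> ('e + nat) list \<Rightarrow> ('e, 's) partial_realization \<Rightarrow> ('e + nat) set) \<Rightarrow> bool" where
  "execution_rule E p f G l k U2 \<longleftrightarrow>
     (\<forall>i \<in> G. \<forall>h. \<forall>\<psi> \<in> partial_realizations E p.
        set h \<subseteq> extended_items E k \<and> l \<le> length h \<and> length h < k \<and>
        dom \<psi> = real_items (set h) \<longrightarrow>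
        top_set (extended_items E k) (k - l) (extended_marginal p f i \<psi>) (U2 i h \<psi>))"

fun initialize :: "(('e + nat) list \<Rightarrow> ('e + nat) set) \<Rightarrow> nat \<Rightarrow> ('e + nat) list pmf" where
  "initialize U1 0 = return_pmf []"
| "initialize U1 (Suc t) =
     bind_pmf (initialize U1 t) (\<lambda>h. map_pmf (\<lambda>e. e # h) (pmf_of_set (U1 h)))"

fun execute ::
  "('g \<Rightarrow> ('e + nat) list \<Rightarrow> ('e, 's) partial_realization \<Rightarrow> ('e + nat) set)
    \<Rightarrow> 'g \<Rightarrow> ('e, 's) realization \<Rightarrow> nat \<Rightarrow> ('e + nat) list \<Rightarrow> ('e + nat) list pmf" where
  "execute U2 i \<phi> 0 h = return_pmf h"
| "execute U2 i \<phi> (Suc n) h =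
     bind_pmf (pmf_of_set (U2 i h (observe \<phi> (real_items (set h)))))
       (\<lambda>e. execute U2 i \<phi> n (e # h))"

definition greedy_selected ::
  "(('e + nat) list \<Rightarrow> ('e + nat) set)
    \<Rightarrow> ('g \<Rightarrow> ('e + nat) list \<Rightarrow> ('e, 's) partial_realization \<Rightarrow> ('e + nat) set)
    \<Rightarrow> nat \<Rightarrow> nat \<Rightarrow> 'g \<Rightarrow> ('e, 's) realization \<Rightarrow> 'e set pmf" where
  "greedy_selected U1 U2 l k i \<phi> =
     bind_pmf (initialize U1 l)
       (\<lambda>h. map_pmf (\<lambda>h'. real_items (set h')) (execute U2 i \<phi> (k - l) h))"

end

theory Submission
  imports Defs
begin

text \<open>
  Follow the greedy policy for \<open>t\<close> rounds, with chosen items \<open>A\<^sub>t\<close>, and let the optimal policy,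
  with fixed set \<open>S\<close>, run independently from the empty set. Sampling uniformly from \<open>r\<close> candidates
  keeps at least a fraction \<open>1 - 1/r\<close> of the expected utility of the union in each round: by
  subadditivity, the marginals of all candidates sum to at least minus the current utility. Hence
  the union keeps a fraction \<open>(1 - 1/l) ^ l * (1 - 1/(k-l)) ^ (k-l) \<ge> 1/16\<close> of the optimum.

  In an execution round \<open>t\<close>, what the optimal policy adds to \<open>A\<^sub>t\<close> is bounded by the marginals of the
  items of \<open>S\<close> plus the marginals of at most \<open>k - l\<close> further items. The latter are at most
  \<open>k - l\<close> times the expected greedy gain in that round. The former do not increase during the run and are,
  summed over the tasks, at most \<open>l\<close> times the gain in any initialization round. Averaging over
  all pairs of an initialization and an execution round, the optimal policy adds at most the final
  greedy utility, which is therefore at least half of \<open>1/16\<close> of the optimum.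
\<close>

section \<open>Averaging over the fibers of a map\<close>

text \<open>Everything depends on observed states, and the prior may have infinite support.
  Conditional expectations are therefore compared through expectations against weights: functions
  with values in [0,1] that depend on the observed states alone. The probability of a policy's
  choice or of a greedy path and the indicator of a candidate set are such weights, so finite sums
  over runs and paths reduce to adaptive submodularity at a single set. The obstacle is the
  initialization, which ranks items by an average over tasks: a candidate may have a negative
  marginal for one task. The retention factor does not suffer, since it rests on nonnegative
  utilities and not on the ranking, and is proved task by task in both phases. What relies on the
  ranking during initialization is proved for sums over \<open>M\<close>, which works because all
  tasks share the initial path. As utilities need not be monotone, the dummies matter: they keep
  every top set free of negative values. The constant 1/16 is the square of 1/4, the value of (1 -
  1/n)^n at n = 2, from which it increases.\<close>

definition unit_weight :: "('a \<Rightarrow> 'b) \<Rightarrow> ('a \<Rightarrow> real) \<Rightarrow> bool" where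
  "unit_weight T W \<longleftrightarrow> (\<forall>x. 0 \<le> W x \<and> W x \<le> 1) \<and> (\<forall>x y. T x = T y \<longrightarrow> W x = W y)"

lemma unit_weightD:
  assumes "unit_weight T W"
  shows "0 \<le> W x" "W x \<le> 1" "T x = T y \<Longrightarrow> W x = W y"
  using assms unfolding unit_weight_def by blast+

abbreviation fiber_pmf :: "'a pmf \<Rightarrow> ('a \<Rightarrow> 'b) \<Rightarrow> 'a \<Rightarrow> 'a pmf" where
  "fiber_pmf p T x \<equiv> cond_pmf p {y. T x = T y}"

text \<open>The law of total expectation in its discrete form: redrawing a point inside its own
  fiber only redistributes mass within that fiber.\<close>

lemma bind_fiber_pmf: "bind_pmf p (fiber_pmf p T) = p"
  by (rule bind_cond_pmf_cancel[where R = "\<lambda>x y. T x = T y"]) (auto simp: eq_commute)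

lemma set_fiber_pmf: "x \<in> set_pmf p \<Longrightarrow> set_pmf (fiber_pmf p T x) = set_pmf p \<inter> {y. T x = T y}"
  by (subst set_cond_pmf) auto

lemma nn_integral_fiber_pmf:
  "(\<integral>\<^sup>+x. (\<integral>\<^sup>+y. h y \<partial>fiber_pmf p T x) \<partial>measure_pmf p) = (\<integral>\<^sup>+x. h x \<partial>measure_pmf p)"
  using nn_integral_bind_pmf[of p "fiber_pmf p T" h] by (simp add: bind_fiber_pmf)

text \<open>For nonnegative \<open>X\<close> the redrawing identity holds for
  \<open>nn_integral\<close> without any integrability. A weight is constant on fibers, so it leaves
  the inner integral, and a finite total forces a finite mean on the fiber of every support
  point.\<close>

lemma fiber_mean_nonneg:
  fixes X W :: "'a \<Rightarrow> real"
  assumes X: "\<And>x. 0 \<le> X x" "integrable (measure_pmf p) X"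
    and W: "unit_weight T W"
  shows "\<And>x. x \<in> set_pmf p \<Longrightarrow> integrable (measure_pmf (fiber_pmf p T x)) X"
    and "integrable (measure_pmf p) (\<lambda>x. measure_pmf.expectation (fiber_pmf p T x) X)"
    and "measure_pmf.expectation p (\<lambda>x. W x * X x) =
      measure_pmf.expectation p (\<lambda>x. W x * measure_pmf.expectation (fiber_pmf p T x) X)"
proof -
  let ?c = "\<lambda>x. measure_pmf.expectation (fiber_pmf p T x) X"
  have "(\<integral>\<^sup>+x. (\<integral>\<^sup>+y. ennreal (X y) \<partial>fiber_pmf p T x) \<partial>measure_pmf p) < \<infinity>"
    unfolding nn_integral_fiber_pmf using X by (simp add: integrable_iff_bounded)
  then have "AE x in measure_pmf p. (\<integral>\<^sup>+y. ennreal (X y) \<partial>fiber_pmf p T x) \<noteq> \<infinity>"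
    by (intro nn_integral_PInf_AE) auto
  then show int: "integrable (measure_pmf (fiber_pmf p T x)) X" if "x \<in> set_pmf p" for x
    using that X(1) by (auto simp: AE_measure_pmf_iff integrable_iff_bounded top.not_eq_extremum)
  have eq: "(\<integral>\<^sup>+x. ennreal (V x * ?c x) \<partial>measure_pmf p) = (\<integral>\<^sup>+x. ennreal (V x * X x) \<partial>measure_pmf p)"
    if V: "\<And>x. 0 \<le> V x" "\<And>x y. T x = T y \<Longrightarrow> V x = V y" for V
  proof -
    have "ennreal (V x * ?c x) = (\<integral>\<^sup>+y. ennreal (V y * X y) \<partial>fiber_pmf p T x)"
      if "x \<in> set_pmf p" for x
    proof -
      have "(\<integral>\<^sup>+y. ennreal (V y * X y) \<partial>fiber_pmf p T x)
          = (\<integral>\<^sup>+y. ennreal (V x) * ennreal (X y) \<partial>fiber_pmf p T x)"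
      proof (intro nn_integral_cong_AE AE_pmfI)
        fix y assume "y \<in> set_pmf (fiber_pmf p T x)"
        then have "V y = V x" using V(2)[of x y] that by (simp add: set_fiber_pmf)
        then show "ennreal (V y * X y) = ennreal (V x) * ennreal (X y)"
          using V(1) by (simp add: ennreal_mult')
      qed
      also have "\<dots> = ennreal (V x) * (\<integral>\<^sup>+y. ennreal (X y) \<partial>fiber_pmf p T x)"
        by (simp add: nn_integral_cmult)
      also have "(\<integral>\<^sup>+y. ennreal (X y) \<partial>fiber_pmf p T x) = ennreal (?c x)"
        using int[OF that] X(1) by (intro nn_integral_eq_integral) auto
      finally show ?thesis using V(1) by (simp add: ennreal_mult')
    qed
    then show ?thesis
      by (subst nn_integral_fiber_pmf[symmetric, where T = T]) (intro nn_integral_cong_AE AE_pmfI)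
  qed
  have c: "0 \<le> ?c x" for x using X(1) by simp
  show "integrable (measure_pmf p) ?c"
    using eq[of "\<lambda>_. 1"] X c by (simp add: integrable_iff_bounded)
  show "measure_pmf.expectation p (\<lambda>x. W x * X x) = measure_pmf.expectation p (\<lambda>x. W x * ?c x)"
    using eq[of W, OF unit_weightD(1,3)[OF W]] unit_weightD(1)[OF W] X(1) c by (simp add: integral_eq_nn_integral)
qed

lemma integrable_mult_unit:
  fixes X W :: "'a \<Rightarrow> real"
  assumes "integrable (measure_pmf p) X" "unit_weight T W"
  shows "integrable (measure_pmf p) (\<lambda>x. W x * X x)"
  by (rule Bochner_Integration.integrable_bound[OF assms(1)])
    (use unit_weightD(1,2)[OF assms(2)] in \<open>auto simp: abs_mult mult_left_le_one_le\<close>)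

lemma fiber_mean:
  fixes X W :: "'a \<Rightarrow> real"
  assumes X: "integrable (measure_pmf p) X"
    and W: "unit_weight T W"
  shows "\<And>x. x \<in> set_pmf p \<Longrightarrow> integrable (measure_pmf (fiber_pmf p T x)) X"
    and "integrable (measure_pmf p) (\<lambda>x. measure_pmf.expectation (fiber_pmf p T x) X)"
    and "measure_pmf.expectation p (\<lambda>x. W x * X x) =
      measure_pmf.expectation p (\<lambda>x. W x * measure_pmf.expectation (fiber_pmf p T x) X)"
proof -
  \<comment> \<open>Positive and negative parts transfer the nonnegative case.\<close>
  define P N where "P = (\<lambda>x. max (X x) 0)" and "N = (\<lambda>x. max (- X x) 0)"
  have PN: "\<And>x. 0 \<le> P x" "\<And>x. 0 \<le> N x" and intPN: "integrable (measure_pmf p) P" "integrable (measure_pmf p) N"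
    using X by (auto simp: P_def N_def)
  have XPN: "X = (\<lambda>x. P x - N x)" by (auto simp: P_def N_def)
  note P = fiber_mean_nonneg[where T = T and W = W and p = p, OF PN(1) intPN(1) W]
  note N = fiber_mean_nonneg[where T = T and W = W and p = p, OF PN(2) intPN(2) W]
  show int: "integrable (measure_pmf (fiber_pmf p T x)) X" if "x \<in> set_pmf p" for x
    unfolding XPN using P(1)[OF that] N(1)[OF that] by (rule Bochner_Integration.integrable_diff)
  have eq: "measure_pmf.expectation (fiber_pmf p T x) X =
      measure_pmf.expectation (fiber_pmf p T x) P - measure_pmf.expectation (fiber_pmf p T x) N"
    if "x \<in> set_pmf p" for x
    unfolding XPN using P(1)[OF that] N(1)[OF that] by (rule Bochner_Integration.integral_diff)
  show "integrable (measure_pmf p) (\<lambda>x. measure_pmf.expectation (fiber_pmf p T x) X)"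
    by (rule integrable_cong_AE_imp[OF Bochner_Integration.integrable_diff[OF P(2) N(2)]])
      (auto simp: AE_measure_pmf_iff eq)
  have "measure_pmf.expectation p (\<lambda>x. W x * X x) =
      measure_pmf.expectation p (\<lambda>x. W x * P x) - measure_pmf.expectation p (\<lambda>x. W x * N x)"
    unfolding XPN right_diff_distrib
    by (intro Bochner_Integration.integral_diff integrable_mult_unit[OF _ W] intPN)
  also have "\<dots> = measure_pmf.expectation p (\<lambda>x. W x * measure_pmf.expectation (fiber_pmf p T x) P
       - W x * measure_pmf.expectation (fiber_pmf p T x) N)"
    unfolding P(3) N(3)
    by (intro Bochner_Integration.integral_diff[symmetric] integrable_mult_unit[OF _ W] P(2) N(2))
  also have "\<dots> = measure_pmf.expectation p (\<lambda>x. W x * measure_pmf.expectation (fiber_pmf p T x) X)"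
    by (intro integral_cong_AE) (auto simp: AE_measure_pmf_iff eq right_diff_distrib)
  finally show "measure_pmf.expectation p (\<lambda>x. W x * X x) =
      measure_pmf.expectation p (\<lambda>x. W x * measure_pmf.expectation (fiber_pmf p T x) X)" .
qed

section \<open>Observations and conditional marginals\<close>

lemma observe_apply: "observe \<phi> Y e = (if e \<in> Y then Some (\<phi> e) else None)"
  by (simp add: observe_def)

lemma observe_eq_iff: "observe \<phi> Y = observe \<phi>' Y \<longleftrightarrow> (\<forall>e\<in>Y. \<phi> e = \<phi>' e)"
proof
  assume "observe \<phi> Y = observe \<phi>' Y"
  then have "observe \<phi> Y e = observe \<phi>' Y e" for e by simp
  then show "\<forall>e\<in>Y. \<phi> e = \<phi>' e" by (metis observe_apply option.inject)
qed (auto simp: observe_apply)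

lemma dom_observe [simp]: "dom (observe \<phi> Y) = Y"
  by (auto simp: observe_def)

lemma agrees_observe: "agrees \<phi>' (observe \<phi> Y) \<longleftrightarrow> observe \<phi> Y = observe \<phi>' Y"
  by (auto simp: observe_eq_iff agrees_def map_le_def observe_apply)

lemma observe_mono: "Y \<subseteq> Y' \<Longrightarrow> observe \<phi> Y \<subseteq>\<^sub>m observe \<phi> Y'"
  by (auto simp: map_le_def observe_def)

lemma observe_in_partial_realizations:
  assumes "\<phi> \<in> set_pmf p" "Y \<subseteq> E"
  shows "observe \<phi> Y \<in> partial_realizations E p"
proof -
  have "agrees \<phi> (observe \<phi> Y)" by (simp add: agrees_observe)
  then have "measure_pmf.prob p {\<phi>'. agrees \<phi>' (observe \<phi> Y)} > 0"
    using assms(1) by (intro measure_pmf_posI[of \<phi>]) auto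
  with assms(2) show ?thesis by (simp add: partial_realizations_def)
qed

text \<open>A larger \<open>Y\<close> admits more weights, so an inequality tested against all
  weights for \<open>Y\<close> becomes stronger as \<open>Y\<close> grows.\<close>

abbreviation weight :: "'e set \<Rightarrow> (('e, 's) realization \<Rightarrow> real) \<Rightarrow> bool" where
  "weight Y \<equiv> unit_weight (\<lambda>\<phi>. observe \<phi> Y)"

lemma weightI:
  assumes "\<And>\<phi>. 0 \<le> W \<phi>" "\<And>\<phi>. W \<phi> \<le> 1"
    and "\<And>\<phi> \<phi>'. observe \<phi> Y = observe \<phi>' Y \<Longrightarrow> W \<phi> = W \<phi>'"
  shows "weight Y W"
  using assms unfolding unit_weight_def by blast

lemma weight_mono: "weight Y W \<Longrightarrow> Y \<subseteq> Y' \<Longrightarrow> weight Y' W"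
  unfolding unit_weight_def observe_eq_iff by blast

lemma weight_mult: "weight Y V \<Longrightarrow> weight Y W \<Longrightarrow> weight Y (\<lambda>\<phi>. V \<phi> * W \<phi>)"
  unfolding unit_weight_def by (metis mult_nonneg_nonneg mult_le_one)

lemma weight_of_bool:
  fixes P :: "('e, 's) realization \<Rightarrow> bool"
  assumes "\<And>\<phi> \<phi>'. observe \<phi> Y = observe \<phi>' Y \<Longrightarrow> P \<phi> = P \<phi>'"
  shows "weight Y (\<lambda>\<phi>. of_bool (P \<phi>))"
proof (rule weightI)
  fix \<phi> \<phi>' :: "('e, 's) realization"
  assume "observe \<phi> Y = observe \<phi>' Y"
  from assms[OF this] show "of_bool (P \<phi>) = (of_bool (P \<phi>') :: real)" by simp
qed auto

lemma weight_one [simp]: "weight Y (\<lambda>_. 1)"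
  by (rule weightI) auto

lemma weight_pmf: "weight Y (\<lambda>\<phi>. pmf (q (observe \<phi> Y)) c)"
  by (rule weightI) (auto simp: pmf_le_1)

lemma real_items_simps [simp]:
  "real_items {} = {}"
  "real_items (insert (Inl e) S) = insert e (real_items S)"
  "real_items (insert (Inr j) S) = real_items S"
  by (auto simp: real_items_def)

lemma real_items_insert: "real_items (insert x S) = real_items {x} \<union> real_items S"
  by (auto simp: real_items_def)

lemma real_items_subset: "S \<subseteq> extended_items E k \<Longrightarrow> real_items S \<subseteq> E"
  by (auto simp: real_items_def extended_items_def)

lemma Inl_in_extended_items [simp]: "Inl e \<in> extended_items E k \<longleftrightarrow> e \<in> E"
  by (auto simp: extended_items_def)

lemma finite_extended_items: "finite E \<Longrightarrow> finite (extended_items E k)"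
  by (simp add: extended_items_def)

lemma expectation_cong:
  fixes X X' :: "'a \<Rightarrow> real"
  assumes "\<And>x. x \<in> set_pmf p \<Longrightarrow> X x = X' x"
  shows "measure_pmf.expectation p X = measure_pmf.expectation p X'"
  by (rule integral_cong_AE) (use assms in \<open>auto simp: AE_measure_pmf_iff\<close>)

lemma expectation_mono:
  fixes X X' :: "'a \<Rightarrow> real"
  assumes "integrable (measure_pmf p) X" "integrable (measure_pmf p) X'"
    and "\<And>x. x \<in> set_pmf p \<Longrightarrow> X x \<le> X' x"
  shows "measure_pmf.expectation p X \<le> measure_pmf.expectation p X'"
  by (rule integral_mono_AE) (use assms in \<open>auto simp: AE_measure_pmf_iff\<close>)

lemma expectation_nonneg:
  fixes X :: "'a \<Rightarrow> real"
  assumes "\<And>x. x \<in> set_pmf p \<Longrightarrow> 0 \<le> X x"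
  shows "0 \<le> measure_pmf.expectation p X"
  by (rule integral_nonneg_AE) (use assms in \<open>auto simp: AE_measure_pmf_iff\<close>)

section \<open>Gains and marginals for a single task\<close>

locale adaptive_task =
  fixes E :: "'e set" and p :: "('e, 's) realization pmf"
    and f :: "('g, 'e, 's) utility" and i :: 'g
  assumes finite_E: "finite E"
    and utility_nonneg: "Y \<subseteq> E \<Longrightarrow> \<phi> \<in> set_pmf p \<Longrightarrow> 0 \<le> f i Y \<phi>"
    and integrable_utility: "Y \<subseteq> E \<Longrightarrow> integrable (measure_pmf p) (f i Y)"
    and submodular: "adaptive_submodular E p f i"
begin

abbreviation Ex :: "(('e, 's) realization \<Rightarrow> real) \<Rightarrow> real" where
  "Ex \<equiv> measure_pmf.expectation p"

abbreviation marginal :: "'e \<Rightarrow> 'e set \<Rightarrow> ('e, 's) realization \<Rightarrow> real" where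
  "marginal e Y \<phi> \<equiv> cond_marginal p f i e (observe \<phi> Y)"

text \<open>The realizations that agree with what \<open>\<phi>\<close> shows on \<open>Y\<close>
  form the fiber of \<open>observe\<close> through \<open>\<phi>\<close>; this is what makes the
  averaging results applicable to marginals.\<close>

lemma marginal_eq_fiber_mean:
  "marginal e Y \<phi> = measure_pmf.expectation (fiber_pmf p (\<lambda>\<phi>. observe \<phi> Y) \<phi>)
     (\<lambda>\<phi>. f i (insert e Y) \<phi> - f i Y \<phi>)"
  by (simp add: cond_marginal_def agrees_observe)

lemma integrable_gain:
  "Y \<subseteq> E \<Longrightarrow> Y' \<subseteq> E \<Longrightarrow> integrable (measure_pmf p) (\<lambda>\<phi>. f i Y' \<phi> - f i Y \<phi>)"
  by (intro Bochner_Integration.integrable_diff integrable_utility)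

lemma integrable_marginal:
  assumes "Y \<subseteq> E" "e \<in> E"
  shows "integrable (measure_pmf p) (marginal e Y)"
  unfolding marginal_eq_fiber_mean[abs_def]
  by (rule fiber_mean(2)[OF integrable_gain weight_one]) (use assms in auto)

lemma expectation_marginal:
  assumes "Y \<subseteq> E" "e \<in> E" "weight Y W"
  shows "Ex (\<lambda>\<phi>. W \<phi> * marginal e Y \<phi>) = Ex (\<lambda>\<phi>. W \<phi> * (f i (insert e Y) \<phi> - f i Y \<phi>))"
  unfolding marginal_eq_fiber_mean[abs_def]
  by (rule fiber_mean(3)[OF integrable_gain assms(3), symmetric]) (use assms in auto)

lemma marginal_in [simp]: "e \<in> Y \<Longrightarrow> marginal e Y \<phi> = 0"
  by (simp add: marginal_eq_fiber_mean insert_absorb)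

text \<open>The condition \<open>e \<notin> Y'\<close> matters: once \<open>e\<close> lies in
  \<open>Y'\<close> its marginal is 0, which may exceed a negative marginal at \<open>Y\<close>.
  Every later use has to treat repeated items separately.\<close>

lemma marginal_antimono:
  assumes "\<phi> \<in> set_pmf p" "Y \<subseteq> Y'" "Y' \<subseteq> E" "e \<in> E" "e \<notin> Y'"
  shows "marginal e Y' \<phi> \<le> marginal e Y \<phi>"
  using submodular observe_in_partial_realizations[OF assms(1,3)]
    observe_in_partial_realizations[OF assms(1), of Y E] observe_mono[OF assms(2), of \<phi>] assms(2-5)
  unfolding adaptive_submodular_def by auto

lemma expectation_gain_le_marginal:
  assumes "Y \<subseteq> Y'" "Y' \<subseteq> E" "e \<in> E" "e \<notin> Y'" "weight Y' W"
  shows "Ex (\<lambda>\<phi>. W \<phi> * (f i (insert e Y') \<phi> - f i Y' \<phi>)) \<le> Ex (\<lambda>\<phi>. W \<phi> * marginal e Y \<phi>)"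
  unfolding expectation_marginal[OF assms(2,3,5), symmetric]
  by (intro expectation_mono integrable_mult_unit[OF _ assms(5)] integrable_marginal
      mult_left_mono marginal_antimono unit_weightD(1)[OF assms(5)]) (use assms in auto)

text \<open>The items of the fixed set \<open>U\<close> are added one at a time. A weight for
  \<open>Y\<close> is also one for the larger set reached so far, so adaptive submodularity bounds
  each gain by the gain at \<open>Y\<close>.\<close>

lemma expectation_gain_subadditive:
  assumes "finite U" "U \<subseteq> extended_items E k" "Y \<subseteq> E" "weight Y W"
  shows "Ex (\<lambda>\<phi>. W \<phi> * (f i (Y \<union> real_items U) \<phi> - f i Y \<phi>))
    \<le> (\<Sum>x\<in>U. Ex (\<lambda>\<phi>. W \<phi> * (f i (Y \<union> real_items {x}) \<phi> - f i Y \<phi>)))"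
  using assms(1,2)
proof (induction U)
  case (insert x U)
  define Y' where "Y' = Y \<union> real_items U"
  have Y': "Y \<subseteq> Y'" "Y' \<subseteq> E" "Y' \<union> real_items {x} \<subseteq> E"
    using real_items_subset insert.prems assms(3) real_items_subset[of "{x}" E k]
      real_items_subset[of U E k] by (auto simp: Y'_def)
  have W': "weight Y' W" using weight_mono[OF assms(4) Y'(1)] .
  have "Ex (\<lambda>\<phi>. W \<phi> * (f i (Y' \<union> real_items {x}) \<phi> - f i Y' \<phi>))
      \<le> Ex (\<lambda>\<phi>. W \<phi> * (f i (Y \<union> real_items {x}) \<phi> - f i Y \<phi>))"
  proof (cases x)
    case (Inl e)
    have e: "e \<in> E" using Inl insert.prems by simp
    show ?thesis
    proof (cases "e \<in> Y'")
      case True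
      \<comment> \<open>Since \<open>x\<close> is new to \<open>U\<close>, the item was in
        \<open>Y\<close> from the start, and both gains vanish.\<close>
      then have "e \<in> Y" using Inl insert.hyps by (auto simp: Y'_def real_items_def)
      with True Inl show ?thesis by (simp add: insert_absorb)
    next
      case False
      with expectation_gain_le_marginal[OF Y'(1,2) e False W'] expectation_marginal[OF assms(3) e assms(4)] Inl
      show ?thesis by simp
    qed
  qed simp
  moreover have "Ex (\<lambda>\<phi>. W \<phi> * (f i (Y \<union> real_items (insert x U)) \<phi> - f i Y \<phi>))
      = Ex (\<lambda>\<phi>. W \<phi> * (f i (Y' \<union> real_items {x}) \<phi> - f i Y' \<phi>)) + Ex (\<lambda>\<phi>. W \<phi> * (f i Y' \<phi> - f i Y \<phi>))"
    unfolding Y'_def[symmetric] real_items_insert[of x U]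
    by (subst Bochner_Integration.integral_add[symmetric])
      (use Y' assms(3) in \<open>auto intro!: integrable_mult_unit[OF _ W'] integrable_gain
         simp: distrib_left[symmetric] Y'_def Un_ac\<close>)
  ultimately show ?case using insert by (simp add: Y'_def)
qed simp

end

section \<open>Running a policy\<close>

lemma expectation_bind_finite:
  fixes F :: "'b \<Rightarrow> real"
  assumes "finite A" "set_pmf p \<subseteq> A" "\<And>x. x \<in> A \<Longrightarrow> finite (set_pmf (g x))"
  shows "measure_pmf.expectation (bind_pmf p g) F = (\<Sum>x\<in>A. pmf p x * measure_pmf.expectation (g x) F)"
  using pmf_expectation_bind[OF assms(1) assms(3) assms(2), where h = F] by simp

text \<open>
  The expectation over \<^const>\<open>run\<close> as an explicit finite sum, so that it is a finite combination of
  products of weights even where the policy is not valid (outside the support of the prior).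
\<close>

fun run_sum :: "'e set \<Rightarrow> (('e, 's) partial_realization \<Rightarrow> 'e option pmf) \<Rightarrow> ('e, 's) realization
    \<Rightarrow> nat \<Rightarrow> ('e set \<Rightarrow> real) \<Rightarrow> 'e set \<Rightarrow> real" where
  "run_sum E q \<phi> 0 F Z = F Z"
| "run_sum E q \<phi> (Suc n) F Z = pmf (q (observe \<phi> Z)) None * F Z +
     (\<Sum>e\<in>E - Z. pmf (q (observe \<phi> Z)) (Some e) * run_sum E q \<phi> n F (insert e Z))"

text \<open>\<open>policies\<close> restricts choices only at partial realizations of positive
  probability. With \<open>\<phi>\<close> fixed, this becomes a condition that can be claimed for
  every \<open>\<phi>\<close> in the support.\<close>

definition valid_policy_at ::
  "'e set \<Rightarrow> (('e, 's) partial_realization \<Rightarrow> 'e option pmf) \<Rightarrow> ('e, 's) realization \<Rightarrow> bool" where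
  "valid_policy_at E q \<phi> \<longleftrightarrow>
     (\<forall>Z \<subseteq> E. set_pmf (q (observe \<phi> Z)) \<subseteq> insert None (Some ` (E - Z)))"

lemma valid_policy_at_policies:
  assumes "\<pi> \<in> policies E p G" "i \<in> G" "\<phi> \<in> set_pmf p"
  shows "valid_policy_at E (\<pi> i) \<phi>"
  unfolding valid_policy_at_def
proof (intro allI impI)
  fix Z assume "Z \<subseteq> E"
  with assms observe_in_partial_realizations[OF assms(3) this]
  show "set_pmf (\<pi> i (observe \<phi> Z)) \<subseteq> insert None (Some ` (E - Z))"
    unfolding policies_def by (metis (mono_tags, lifting) dom_observe mem_Collect_eq)
qed

lemma valid_policy_atD:
  assumes "valid_policy_at E q \<phi>" "Z \<subseteq> E"
  shows "set_pmf (q (observe \<phi> Z)) \<subseteq> insert None (Some ` (E - Z))"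
  using assms by (auto simp: valid_policy_at_def)

lemma set_run:
  assumes "valid_policy_at E (\<pi> i) \<phi>" "Z \<subseteq> E"
  shows "Y \<in> set_pmf (run \<pi> i \<phi> n Z) \<Longrightarrow> Z \<subseteq> Y \<and> Y \<subseteq> E"
  using assms(2)
proof (induction n arbitrary: Z)
  case (Suc n)
  from Suc.prems(1) obtain c where c: "c \<in> set_pmf (\<pi> i (observe \<phi> Z))"
    and Y: "Y \<in> set_pmf (case c of None \<Rightarrow> return_pmf Z | Some e \<Rightarrow> run \<pi> i \<phi> n (insert e Z))"
    by (auto simp: set_bind_pmf)
  show ?case
  proof (cases c)
    case None
    with Y Suc.prems(2) show ?thesis by simp
  next
    case (Some e)
    with c valid_policy_atD[OF assms(1) Suc.prems(2)] have "e \<in> E" by auto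
    with Suc.IH[of "insert e Z"] Y Some Suc.prems(2) show ?thesis by auto
  qed
qed auto

lemma finite_set_run:
  assumes "finite E" "valid_policy_at E (\<pi> i) \<phi>" "Z \<subseteq> E"
  shows "finite (set_pmf (run \<pi> i \<phi> n Z))"
  by (rule finite_subset[of _ "Pow E"]) (use set_run[where \<pi> = \<pi> and i = i, OF assms(2,3)] assms(1) in auto)

lemma expectation_run:
  assumes "finite E" "valid_policy_at E (\<pi> i) \<phi>" "Z \<subseteq> E"
  shows "measure_pmf.expectation (run \<pi> i \<phi> n Z) F = run_sum E (\<pi> i) \<phi> n F Z"
  using assms(3)
proof (induction n arbitrary: Z)
  case (Suc n)
  let ?g = "\<lambda>c. case c of None \<Rightarrow> return_pmf Z | Some e \<Rightarrow> run \<pi> i \<phi> n (insert e Z)"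
  have "measure_pmf.expectation (run \<pi> i \<phi> (Suc n) Z) F
      = (\<Sum>c\<in>insert None (Some ` (E - Z)). pmf (\<pi> i (observe \<phi> Z)) c * measure_pmf.expectation (?g c) F)"
    unfolding run.simps
    by (rule expectation_bind_finite)
      (use assms(1,2) Suc.prems valid_policy_atD[OF assms(2) Suc.prems] in
        \<open>auto split: option.split intro!: finite_set_run\<close>)
  also have "\<dots> = run_sum E (\<pi> i) \<phi> (Suc n) F Z"
    using assms(1) Suc by (simp add: sum.reindex)
  finally show ?case .
qed simp

text \<open>If \<open>n\<close> items are missing and \<open>n\<close> steps surely produce
  \<open>S\<close>, every one of these steps must add an item. Stopping early is impossible, so the
  longer run passes through the same forced steps and only adds to \<open>S\<close>
  afterwards.\<close>

lemma run_forced_subset: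
  assumes "valid_policy_at E (\<pi> i) \<phi>" "Z \<subseteq> E" "finite S"
    and "set_pmf (run \<pi> i \<phi> n Z) \<subseteq> {S}" "card S = card Z + n" "finite Z"
    and "Y \<in> set_pmf (run \<pi> i \<phi> (n + m) Z)"
  shows "S \<subseteq> Y"
  using assms(2,4-7)
proof (induction n arbitrary: Z)
  case 0
  with set_run[where \<pi> = \<pi> and i = i, OF assms(1) 0(1)] show ?case by auto
next
  case (Suc n)
  let ?g = "\<lambda>n c. case c of None \<Rightarrow> return_pmf Z | Some e \<Rightarrow> run \<pi> i \<phi> n (insert e Z)"
  from Suc.prems(5) obtain c where c: "c \<in> set_pmf (\<pi> i (observe \<phi> Z))"
    and Y: "Y \<in> set_pmf (?g (n + m) c)"
    by (auto simp: set_bind_pmf)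
  have sub: "set_pmf (?g n c) \<subseteq> {S}"
    using Suc.prems(2) c by (auto simp: set_bind_pmf)
  show ?case
  proof (cases c)
    case None
    with sub Suc.prems(3) show ?thesis by auto
  next
    case (Some e)
    with c valid_policy_atD[OF assms(1) Suc.prems(1)] have "e \<in> E" "e \<notin> Z" by auto
    with Suc.IH[of "insert e Z"] Y sub Some Suc.prems show ?thesis by auto
  qed
qed

section \<open>Expectations carried along a run of a policy\<close>

context adaptive_task
begin

lemma integrable_run_sum:
  assumes "\<And>Z. Z \<subseteq> E \<Longrightarrow> integrable (measure_pmf p) (F Z)" "Z \<subseteq> E"
  shows "integrable (measure_pmf p) (\<lambda>\<phi>. run_sum E q \<phi> n (\<lambda>Z. F Z \<phi>) Z)"
  using assms(2)
proof (induction n arbitrary: Z)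
  case (Suc n)
  have "integrable (measure_pmf p) (\<lambda>\<phi>. pmf (q (observe \<phi> Z)) c * X \<phi>)"
    if "integrable (measure_pmf p) X" for c X
    using that weight_pmf by (rule integrable_mult_unit)
  with Suc assms(1) show ?case
    by (auto intro!: Bochner_Integration.integrable_add Bochner_Integration.integrable_sum)
qed (use assms(1) in simp)

lemma expectation_run_sum_Suc:
  assumes int: "\<And>Z. Z \<subseteq> E \<Longrightarrow> integrable (measure_pmf p) (F Z)"
    and "Z \<subseteq> E" "weight (Y \<union> Z) W"
  shows "Ex (\<lambda>\<phi>. W \<phi> * run_sum E q \<phi> (Suc n) (\<lambda>Z. F Z \<phi>) Z)
      = Ex (\<lambda>\<phi>. W \<phi> * pmf (q (observe \<phi> Z)) None * F Z \<phi>)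
        + (\<Sum>e\<in>E - Z. Ex (\<lambda>\<phi>. W \<phi> * pmf (q (observe \<phi> Z)) (Some e)
            * run_sum E q \<phi> n (\<lambda>Z. F Z \<phi>) (insert e Z)))"
proof -
  let ?V = "\<lambda>c \<phi>. W \<phi> * pmf (q (observe \<phi> Z)) c"
  let ?R = "\<lambda>Z \<phi>. run_sum E q \<phi> n (\<lambda>Z. F Z \<phi>) Z"
  have V: "weight (Y \<union> Z) (?V c)" for c
    by (rule weight_mult[OF assms(3) weight_mono[OF weight_pmf]]) auto
  note intV = integrable_mult_unit[OF _ V]
  have "Ex (\<lambda>\<phi>. W \<phi> * run_sum E q \<phi> (Suc n) (\<lambda>Z. F Z \<phi>) Z)
      = Ex (\<lambda>\<phi>. ?V None \<phi> * F Z \<phi> + (\<Sum>e\<in>E - Z. ?V (Some e) \<phi> * ?R (insert e Z) \<phi>))"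
    by (simp add: distrib_left sum_distrib_left mult.assoc)
  also have "\<dots> = Ex (\<lambda>\<phi>. ?V None \<phi> * F Z \<phi>) + (\<Sum>e\<in>E - Z. Ex (\<lambda>\<phi>. ?V (Some e) \<phi> * ?R (insert e Z) \<phi>))"
    using assms(2)
    by (subst Bochner_Integration.integral_add)
      (auto intro!: Bochner_Integration.integral_sum Bochner_Integration.integrable_sum intV int integrable_run_sum)
  finally show ?thesis .
qed

text \<open>A drift argument: the probability of each choice depends on observed states, so it is
  absorbed into the weight, where the one-step bound applies; validity makes these probabilities add
  up to 1. The set \<open>Y\<close> holds further items, later the greedy ones, whose states may
  also enter the weight.\<close>

lemma run_sum_supermartingale:
  assumes valid: "\<And>\<phi>. \<phi> \<in> set_pmf p \<Longrightarrow> valid_policy_at E q \<phi>"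
    and int: "\<And>Z. Z \<subseteq> E \<Longrightarrow> integrable (measure_pmf p) (F Z)"
    and step: "\<And>Z e W. Z \<subseteq> E \<Longrightarrow> e \<in> E - Z \<Longrightarrow> weight (Y \<union> Z) W \<Longrightarrow>
      Ex (\<lambda>\<phi>. W \<phi> * F (insert e Z) \<phi>) \<le> Ex (\<lambda>\<phi>. W \<phi> * F Z \<phi>)"
    and "Z \<subseteq> E" "weight (Y \<union> Z) W"
  shows "Ex (\<lambda>\<phi>. W \<phi> * run_sum E q \<phi> n (\<lambda>Z. F Z \<phi>) Z) \<le> Ex (\<lambda>\<phi>. W \<phi> * F Z \<phi>)"
  using assms(4,5)
proof (induction n arbitrary: Z W)
  case (Suc n)
  let ?V = "\<lambda>c \<phi>. W \<phi> * pmf (q (observe \<phi> Z)) c"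
  let ?R = "\<lambda>Z \<phi>. run_sum E q \<phi> n (\<lambda>Z. F Z \<phi>) Z"
  have V: "weight (Y \<union> Z) (?V c)" for c
    by (rule weight_mult[OF Suc.prems(2) weight_mono[OF weight_pmf]]) auto
  note intV = integrable_mult_unit[OF _ V]
  have "Ex (\<lambda>\<phi>. W \<phi> * run_sum E q \<phi> (Suc n) (\<lambda>Z. F Z \<phi>) Z)
      = Ex (\<lambda>\<phi>. ?V None \<phi> * F Z \<phi>) + (\<Sum>e\<in>E - Z. Ex (\<lambda>\<phi>. ?V (Some e) \<phi> * ?R (insert e Z) \<phi>))"
    by (rule expectation_run_sum_Suc[OF int Suc.prems])
  also have "\<dots> \<le> Ex (\<lambda>\<phi>. ?V None \<phi> * F Z \<phi>) + (\<Sum>e\<in>E - Z. Ex (\<lambda>\<phi>. ?V (Some e) \<phi> * F Z \<phi>))"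
  proof (intro add_left_mono sum_mono)
    fix e assume e: "e \<in> E - Z"
    have "Ex (\<lambda>\<phi>. ?V (Some e) \<phi> * ?R (insert e Z) \<phi>) \<le> Ex (\<lambda>\<phi>. ?V (Some e) \<phi> * F (insert e Z) \<phi>)"
      by (rule Suc.IH) (use e Suc.prems in \<open>auto intro!: weight_mono[OF V]\<close>)
    also have "\<dots> \<le> Ex (\<lambda>\<phi>. ?V (Some e) \<phi> * F Z \<phi>)"
      by (rule step) (use e Suc.prems V in auto)
    finally show "Ex (\<lambda>\<phi>. ?V (Some e) \<phi> * ?R (insert e Z) \<phi>) \<le> Ex (\<lambda>\<phi>. ?V (Some e) \<phi> * F Z \<phi>)" .
  qed
  also have "\<dots> = Ex (\<lambda>\<phi>. ?V None \<phi> * F Z \<phi> + (\<Sum>e\<in>E - Z. ?V (Some e) \<phi> * F Z \<phi>))"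
    using Suc.prems
    by (subst Bochner_Integration.integral_add)
      (auto intro!: Bochner_Integration.integral_sum[symmetric] Bochner_Integration.integrable_sum intV int)
  also have "\<dots> = Ex (\<lambda>\<phi>. W \<phi> * F Z \<phi>)"
  proof (rule expectation_cong)
    fix \<phi> assume "\<phi> \<in> set_pmf p"
    have "(\<Sum>c\<in>insert None (Some ` (E - Z)). pmf (q (observe \<phi> Z)) c) = 1"
      by (rule sum_pmf_eq_1) (use finite_E valid_policy_atD[OF valid] \<open>\<phi> \<in> set_pmf p\<close> Suc.prems in auto)
    then have "pmf (q (observe \<phi> Z)) None + (\<Sum>e\<in>E - Z. pmf (q (observe \<phi> Z)) (Some e)) = 1"
      using finite_E by (simp add: sum.reindex)
    moreover have "?V None \<phi> * F Z \<phi> + (\<Sum>e\<in>E - Z. ?V (Some e) \<phi> * F Z \<phi>)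
        = (pmf (q (observe \<phi> Z)) None + (\<Sum>e\<in>E - Z. pmf (q (observe \<phi> Z)) (Some e))) * (W \<phi> * F Z \<phi>)"
      by (simp add: distrib_left distrib_right sum_distrib_left sum_distrib_right mult_ac)
    ultimately show "?V None \<phi> * F Z \<phi> + (\<Sum>e\<in>E - Z. ?V (Some e) \<phi> * F Z \<phi>) = W \<phi> * F Z \<phi>"
      by simp
  qed
  finally show ?case .
qed simp

text \<open>\<open>F\<close> may be negative at some realizations; only its conditional expectations
  have a sign. This suffices because \<open>run_sum\<close> is a finite sum of its values times
  choice probabilities, each absorbed into the weight.\<close>

lemma run_sum_nonneg:
  assumes int: "\<And>Z. Z \<subseteq> E \<Longrightarrow> integrable (measure_pmf p) (F Z)"
    and nonneg: "\<And>Z W. Z \<subseteq> E \<Longrightarrow> weight (Y \<union> Z) W \<Longrightarrow> 0 \<le> Ex (\<lambda>\<phi>. W \<phi> * F Z \<phi>)"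
    and "Z \<subseteq> E" "weight (Y \<union> Z) W"
  shows "0 \<le> Ex (\<lambda>\<phi>. W \<phi> * run_sum E q \<phi> n (\<lambda>Z. F Z \<phi>) Z)"
  using assms(3,4)
proof (induction n arbitrary: Z W)
  case (Suc n)
  let ?V = "\<lambda>c \<phi>. W \<phi> * pmf (q (observe \<phi> Z)) c"
  let ?R = "\<lambda>Z \<phi>. run_sum E q \<phi> n (\<lambda>Z. F Z \<phi>) Z"
  have V: "weight (Y \<union> Z) (?V c)" for c
    by (rule weight_mult[OF Suc.prems(2) weight_mono[OF weight_pmf]]) auto
  have "Ex (\<lambda>\<phi>. W \<phi> * run_sum E q \<phi> (Suc n) (\<lambda>Z. F Z \<phi>) Z)
      = Ex (\<lambda>\<phi>. ?V None \<phi> * F Z \<phi>) + (\<Sum>e\<in>E - Z. Ex (\<lambda>\<phi>. ?V (Some e) \<phi> * ?R (insert e Z) \<phi>))"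
    by (rule expectation_run_sum_Suc[OF int Suc.prems])
  also have "\<dots> \<ge> 0"
  proof (intro add_nonneg_nonneg sum_nonneg nonneg V)
    fix e assume e: "e \<in> E - Z"
    show "0 \<le> Ex (\<lambda>\<phi>. ?V (Some e) \<phi> * ?R (insert e Z) \<phi>)"
      by (rule Suc.IH) (use e Suc.prems in \<open>auto intro!: weight_mono[OF V]\<close>)
  qed (use Suc.prems in auto)
  finally show ?case .
qed (use nonneg in simp)

end

section \<open>Expectations over greedy histories\<close>

definition histories :: "'a set \<Rightarrow> nat \<Rightarrow> 'a list set" where
  "histories A t = {h. set h \<subseteq> A \<and> length h = t}"

lemma finite_histories: "finite A \<Longrightarrow> finite (histories A t)"
  by (simp add: histories_def finite_lists_length_eq)

lemma histories_0 [simp]: "histories A 0 = {[]}"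
  by (auto simp: histories_def)

lemma sum_histories_Suc:
  assumes "finite A"
  shows "(\<Sum>h\<in>histories A (Suc t). F h) = (\<Sum>h\<in>histories A t. \<Sum>x\<in>A. F (x # h))"
proof -
  have "histories A (Suc t) = (\<lambda>(h, x). x # h) ` (histories A t \<times> A)"
    by (auto simp: histories_def image_iff length_Suc_conv)
  then have "(\<Sum>h\<in>histories A (Suc t). F h) = (\<Sum>(h, x)\<in>histories A t \<times> A. F (x # h))"
    by (simp add: sum.reindex inj_on_def case_prod_unfold)
  then show ?thesis by (simp add: sum.cartesian_product)
qed

text \<open>The probability that uniform sampling from the candidate sets produces the given
  history, latest item first. Being a plain function of \<open>V\<close>, it can vary with the
  realization and serve as a weight.\<close>

fun path_weight :: "('a list \<Rightarrow> 'a set) \<Rightarrow> 'a list \<Rightarrow> real" where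
  "path_weight V [] = 1"
| "path_weight V (x # h) = path_weight V h * (of_bool (x \<in> V h) / real (card (V h)))"

lemma path_weight_nonneg: "0 \<le> path_weight V h"
  by (induction h) auto

lemma sum_path_weight_Suc:
  assumes "finite A"
  shows "(\<Sum>h\<in>histories A (Suc t). path_weight V h * F h)
    = (\<Sum>h\<in>histories A t. path_weight V h * ((\<Sum>x\<in>A. of_bool (x \<in> V h) * F (x # h)) / real (card (V h))))"
  unfolding sum_histories_Suc[OF assms]
  by (intro sum.cong refl) (simp add: sum_distrib_left sum_divide_distrib mult_ac)

lemma run_sum_cmult:
  "run_sum E q \<phi> n (\<lambda>Z. c * F Z) Z = c * run_sum E q \<phi> n F Z"
  by (induction n arbitrary: Z) (simp_all add: algebra_simps sum_distrib_left)

lemma run_sum_zero: "run_sum E q \<phi> n (\<lambda>Z. 0) Z = 0"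
  by (induction n arbitrary: Z) simp_all

lemma run_sum_add:
  "run_sum E q \<phi> n (\<lambda>Z. F Z + F' Z) Z = run_sum E q \<phi> n F Z + run_sum E q \<phi> n F' Z"
  by (induction n arbitrary: Z) (simp_all add: algebra_simps sum.distrib)

lemma run_sum_diff:
  "run_sum E q \<phi> n (\<lambda>Z. F Z - F' Z) Z = run_sum E q \<phi> n F Z - run_sum E q \<phi> n F' Z"
  using run_sum_add[of E q \<phi> n F' "\<lambda>Z. F Z - F' Z" Z] by simp

lemma run_sum_sum:
  "run_sum E q \<phi> n (\<lambda>Z. \<Sum>x\<in>A. F x Z) Z = (\<Sum>x\<in>A. run_sum E q \<phi> n (F x) Z)"
  by (induction A rule: infinite_finite_induct) (simp_all add: run_sum_zero run_sum_add)

lemma run_sum_le: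
  assumes "finite E" "valid_policy_at E (\<pi> i) \<phi>" "Z \<subseteq> E"
    and "\<And>Y. Y \<in> set_pmf (run \<pi> i \<phi> n Z) \<Longrightarrow> F Y \<le> c"
  shows "run_sum E (\<pi> i) \<phi> n F Z \<le> c"
  unfolding expectation_run[where \<pi> = \<pi> and i = i, OF assms(1-3), symmetric]
  by (intro measure_pmf.integral_le_const integrable_measure_pmf_finite AE_pmfI assms(4)
      finite_set_run[where \<pi> = \<pi> and i = i, OF assms(1-3)])

section \<open>Inequalities between conditional expectations\<close>

context adaptive_task
begin

text \<open>
  \<open>le_given Y F F'\<close> says that the conditional expectation of \<open>F\<close> given the states on \<open>Y\<close> is at most
  that of \<open>F'\<close>.
\<close>

definition le_given :: "'e set \<Rightarrow> (('e, 's) realization \<Rightarrow> real) \<Rightarrow> (('e, 's) realization \<Rightarrow> real) \<Rightarrow> bool" where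
  "le_given Y F F' \<longleftrightarrow> integrable (measure_pmf p) F \<and> integrable (measure_pmf p) F' \<and>
     (\<forall>W. weight Y W \<longrightarrow> Ex (\<lambda>\<phi>. W \<phi> * F \<phi>) \<le> Ex (\<lambda>\<phi>. W \<phi> * F' \<phi>))"

lemma le_given_pointwise:
  assumes "integrable (measure_pmf p) F" "integrable (measure_pmf p) F'"
    and "\<And>\<phi>. \<phi> \<in> set_pmf p \<Longrightarrow> F \<phi> \<le> F' \<phi>"
  shows "le_given Y F F'"
  unfolding le_given_def
proof (intro conjI allI impI assms(1,2))
  fix W :: "('e, 's) realization \<Rightarrow> real" assume W: "weight Y W"
  show "Ex (\<lambda>\<phi>. W \<phi> * F \<phi>) \<le> Ex (\<lambda>\<phi>. W \<phi> * F' \<phi>)"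
    by (intro expectation_mono mult_left_mono integrable_mult_unit[OF _ W] unit_weightD(1)[OF W] assms)
qed

lemma le_given_refl: "integrable (measure_pmf p) F \<Longrightarrow> le_given Y F F"
  by (simp add: le_given_def)

lemma le_given_add:
  assumes "le_given Y F F'" "le_given Y H H'"
  shows "le_given Y (\<lambda>\<phi>. F \<phi> + H \<phi>) (\<lambda>\<phi>. F' \<phi> + H' \<phi>)"
  using assms unfolding le_given_def
  by (auto simp: distrib_left integrable_mult_unit intro!: add_mono)

lemma le_given_sum:
  assumes "\<And>x. x \<in> A \<Longrightarrow> le_given Y (F x) (F' x)"
  shows "le_given Y (\<lambda>\<phi>. \<Sum>x\<in>A. F x \<phi>) (\<lambda>\<phi>. \<Sum>x\<in>A. F' x \<phi>)"
  using assms
  by (induction A rule: infinite_finite_induct) (auto intro: le_given_add le_given_refl)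

lemma le_given_cmult:
  assumes "le_given Y F F'" "0 \<le> c"
  shows "le_given Y (\<lambda>\<phi>. c * F \<phi>) (\<lambda>\<phi>. c * F' \<phi>)"
  using assms unfolding le_given_def by (simp add: mult.left_commute[of _ c] mult_left_mono)

lemma le_given_weight:
  assumes "le_given Y F F'" "weight Y V"
  shows "le_given Y (\<lambda>\<phi>. V \<phi> * F \<phi>) (\<lambda>\<phi>. V \<phi> * F' \<phi>)"
  using assms weight_mult[OF _ assms(2)] unfolding le_given_def
  by (auto simp: mult.assoc[symmetric] intro: integrable_mult_unit)

lemma le_givenD:
  "le_given Y F F' \<Longrightarrow> weight Y W \<Longrightarrow> Ex (\<lambda>\<phi>. W \<phi> * F \<phi>) \<le> Ex (\<lambda>\<phi>. W \<phi> * F' \<phi>)"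
  by (simp add: le_given_def)

lemma le_given_integrable:
  "le_given Y F F' \<Longrightarrow> integrable (measure_pmf p) F"
  "le_given Y F F' \<Longrightarrow> integrable (measure_pmf p) F'"
  by (auto simp: le_given_def)

abbreviation ext_marginal :: "('e + nat) \<Rightarrow> 'e set \<Rightarrow> ('e, 's) realization \<Rightarrow> real" where
  "ext_marginal x Y \<phi> \<equiv> extended_marginal p f i (observe \<phi> Y) x"

text \<open>The marginal and the actual gain usually differ at a single realization but agree in
  conditional expectation; the two directions together express this equality.\<close>

lemma ext_marginal_gain:
  assumes "Y \<subseteq> E" "x \<in> extended_items E k"
  shows "le_given Y (ext_marginal x Y) (\<lambda>\<phi>. f i (Y \<union> real_items {x}) \<phi> - f i Y \<phi>)"
    and "le_given Y (\<lambda>\<phi>. f i (Y \<union> real_items {x}) \<phi> - f i Y \<phi>) (ext_marginal x Y)"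
proof -
  have "le_given Y (ext_marginal x Y) (\<lambda>\<phi>. f i (Y \<union> real_items {x}) \<phi> - f i Y \<phi>)
     \<and> le_given Y (\<lambda>\<phi>. f i (Y \<union> real_items {x}) \<phi> - f i Y \<phi>) (ext_marginal x Y)"
    using assms
    by (cases x) (auto simp: le_given_def expectation_marginal integrable_marginal intro!: integrable_gain)
  then show "le_given Y (ext_marginal x Y) (\<lambda>\<phi>. f i (Y \<union> real_items {x}) \<phi> - f i Y \<phi>)"
    and "le_given Y (\<lambda>\<phi>. f i (Y \<union> real_items {x}) \<phi> - f i Y \<phi>) (ext_marginal x Y)" by auto
qed

lemma gain_subadditive:
  assumes "U \<subseteq> extended_items E k" "Y \<subseteq> E"
  shows "le_given Y (\<lambda>\<phi>. f i (Y \<union> real_items U) \<phi> - f i Y \<phi>)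
    (\<lambda>\<phi>. \<Sum>x\<in>U. f i (Y \<union> real_items {x}) \<phi> - f i Y \<phi>)"
proof -
  have fin: "finite U" using assms(1) finite_E finite_extended_items finite_subset by blast
  have sub: "Y \<union> real_items X \<subseteq> E" if "X \<subseteq> U" for X
    using real_items_subset[of X E k] that assms by auto
  have int: "integrable (measure_pmf p) (\<lambda>\<phi>. f i (Y \<union> real_items X) \<phi> - f i Y \<phi>)" if "X \<subseteq> U" for X
    using sub[OF that] assms(2) by (intro integrable_gain)
  have int': "integrable (measure_pmf p) (\<lambda>\<phi>. f i (Y \<union> real_items {x}) \<phi> - f i Y \<phi>)" if "x \<in> U" for x
    using int[of "{x}"] that by simp
  show ?thesis
    unfolding le_given_def
  proof (intro conjI allI impI)
    fix W :: "('e, 's) realization \<Rightarrow> real" assume W: "weight Y W"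
    have "Ex (\<lambda>\<phi>. W \<phi> * (\<Sum>x\<in>U. f i (Y \<union> real_items {x}) \<phi> - f i Y \<phi>))
        = (\<Sum>x\<in>U. Ex (\<lambda>\<phi>. W \<phi> * (f i (Y \<union> real_items {x}) \<phi> - f i Y \<phi>)))"
      unfolding sum_distrib_left
      by (rule Bochner_Integration.integral_sum) (rule integrable_mult_unit[OF int' W])
    with expectation_gain_subadditive[OF fin assms W]
    show "Ex (\<lambda>\<phi>. W \<phi> * (f i (Y \<union> real_items U) \<phi> - f i Y \<phi>))
        \<le> Ex (\<lambda>\<phi>. W \<phi> * (\<Sum>x\<in>U. f i (Y \<union> real_items {x}) \<phi> - f i Y \<phi>))" by simp
  qed (use int int' in \<open>auto intro!: Bochner_Integration.integrable_sum\<close>)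
qed

end

abbreviation chosen :: "('e + nat) list \<Rightarrow> 'e set" where
  "chosen h \<equiv> real_items (set h)"

text \<open>Only the form of the sampling is fixed: the number of candidates per round, and that
  they are determined by the history and the states of its items. The ranking is kept out because
  the initialization ranks by all tasks, not by the single task \<open>i\<close>.\<close>

locale greedy_task = adaptive_task E p f i
  for E :: "'e set" and p :: "('e, 's) realization pmf"
    and f :: "('g, 'e, 's) utility" and i :: 'g +
  fixes V :: "('e, 's) realization \<Rightarrow> ('e + nat) list \<Rightarrow> ('e + nat) set"
    and k :: nat and r :: "nat \<Rightarrow> nat"
  assumes V_subset: "\<phi> \<in> set_pmf p \<Longrightarrow> h \<in> histories (extended_items E k) t \<Longrightarrow> t < k \<Longrightarrow>
      V \<phi> h \<subseteq> extended_items E k"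
    and V_card: "\<phi> \<in> set_pmf p \<Longrightarrow> h \<in> histories (extended_items E k) t \<Longrightarrow> t < k \<Longrightarrow>
      card (V \<phi> h) = r t"
    and r_pos: "t < k \<Longrightarrow> 0 < r t"
    and V_observe: "observe \<phi> (real_items (set h)) = observe \<phi>' (real_items (set h)) \<Longrightarrow> V \<phi> h = V \<phi>' h"
begin

abbreviation items :: "('e + nat) set" where "items \<equiv> extended_items E k"

definition path_mean :: "nat \<Rightarrow> (('e + nat) list \<Rightarrow> ('e, 's) realization \<Rightarrow> real) \<Rightarrow> real" where
  "path_mean t F = Ex (\<lambda>\<phi>. \<Sum>h\<in>histories items t. path_weight (V \<phi>) h * F h \<phi>)"

lemma finite_items: "finite items"
  using finite_E by (rule finite_extended_items)

lemma chosen_subset: "h \<in> histories items t \<Longrightarrow> chosen h \<subseteq> E"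
  using real_items_subset by (auto simp: histories_def)

lemma chosen_Cons: "chosen (x # h) = chosen h \<union> real_items {x}"
  using real_items_insert[of x "set h"] by auto

lemma chosen_Cons_subset: "h \<in> histories items t \<Longrightarrow> x \<in> items \<Longrightarrow> chosen (x # h) \<subseteq> E"
  by (rule chosen_subset[of _ "Suc t"]) (auto simp: histories_def)

lemma weight_in_V: "weight (chosen h) (\<lambda>\<phi>. of_bool (x \<in> V \<phi> h))"
  by (rule weight_of_bool) (use V_observe in blast)

text \<open>The candidates of each round are determined by the items chosen before it, so the
  probability of the whole path uses no state outside \<open>chosen h\<close>.\<close>

lemma weight_path_weight: "weight (chosen h) (\<lambda>\<phi>. path_weight (V \<phi>) h)"
proof (induction h)
  case (Cons x h)
  have "weight (chosen h) (\<lambda>\<phi>. of_bool (x \<in> V \<phi> h) / real (card (V \<phi> h)))"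
  proof (rule weightI)
    fix \<phi>
    show "of_bool (x \<in> V \<phi> h) / real (card (V \<phi> h)) \<le> 1"
      by (cases "card (V \<phi> h)") (auto simp: field_simps)
    fix \<phi>' assume "observe \<phi> (chosen h) = observe \<phi>' (chosen h)"
    then have "V \<phi> h = V \<phi>' h" by (rule V_observe)
    then show "of_bool (x \<in> V \<phi> h) / real (card (V \<phi> h)) = of_bool (x \<in> V \<phi>' h) / real (card (V \<phi>' h))"
      by simp
  qed auto
  from weight_mult[OF Cons this] show ?case
    unfolding path_weight.simps by (rule weight_mono) (auto simp only: chosen_Cons)
qed simp

lemma path_mean_eq_sum:
  assumes "\<And>h. h \<in> histories items t \<Longrightarrow> integrable (measure_pmf p) (F h)"
  shows "path_mean t F = (\<Sum>h\<in>histories items t. Ex (\<lambda>\<phi>. path_weight (V \<phi>) h * F h \<phi>))"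
  unfolding path_mean_def
  by (rule Bochner_Integration.integral_sum) (intro integrable_mult_unit[OF _ weight_path_weight] assms)

lemma path_mean_Suc:
  assumes "t < k"
  shows "path_mean (Suc t) F
    = path_mean t (\<lambda>h \<phi>. 1 / real (r t) * (\<Sum>x\<in>items. of_bool (x \<in> V \<phi> h) * F (x # h) \<phi>))"
  unfolding path_mean_def sum_path_weight_Suc[OF finite_items]
  by (intro expectation_cong sum.cong refl) (simp add: V_card assms)

lemma path_mean_mono:
  assumes "\<And>h. h \<in> histories items t \<Longrightarrow> le_given (chosen h) (F h) (F' h)"
  shows "path_mean t F \<le> path_mean t F'"
proof -
  have int: "integrable (measure_pmf p) (F h)" "integrable (measure_pmf p) (F' h)"
    if "h \<in> histories items t" for h
    using le_given_integrable[OF assms[OF that]] .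
  show ?thesis
    unfolding path_mean_eq_sum[of t F, OF int(1), simplified] path_mean_eq_sum[of t F', OF int(2), simplified]
    using le_givenD[OF assms weight_path_weight] by (rule sum_mono)
qed

lemma path_mean_add:
  assumes "\<And>h. h \<in> histories items t \<Longrightarrow> integrable (measure_pmf p) (F h)"
    and "\<And>h. h \<in> histories items t \<Longrightarrow> integrable (measure_pmf p) (F' h)"
  shows "path_mean t (\<lambda>h \<phi>. F h \<phi> + F' h \<phi>) = path_mean t F + path_mean t F'"
  using assms
  by (simp add: path_mean_eq_sum distrib_left sum.distrib integrable_mult_unit[OF _ weight_path_weight])

lemma path_mean_cmult: "path_mean t (\<lambda>h \<phi>. c * F h \<phi>) = c * path_mean t F"
  by (simp add: path_mean_def mult.left_commute[of _ c] sum_distrib_left[symmetric])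

lemma path_mean_cong:
  assumes "\<And>h \<phi>. h \<in> histories items t \<Longrightarrow> \<phi> \<in> set_pmf p \<Longrightarrow> F h \<phi> = F' h \<phi>"
  shows "path_mean t F = path_mean t F'"
  unfolding path_mean_def by (intro expectation_cong sum.cong refl) (simp add: assms)

lemma sum_in_V:
  fixes F :: "'e + nat \<Rightarrow> real"
  assumes "\<phi> \<in> set_pmf p" "h \<in> histories items t" "t < k"
  shows "(\<Sum>x\<in>items. of_bool (x \<in> V \<phi> h) * F x) = (\<Sum>x\<in>V \<phi> h. F x)"
  by (rule sum.mono_neutral_cong_right[OF finite_items V_subset[OF assms]]) auto

end

section \<open>Bounds for one round and one task\<close>

context greedy_task
begin

text \<open>The candidates' marginals are summed, not averaged, so this is \<open>r t\<close> times
  the expected increase of the round. It is the form in which top sets are compared with other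
  sets.\<close>

abbreviation gain :: "('e + nat) list \<Rightarrow> ('e, 's) realization \<Rightarrow> real" where
  "gain h \<phi> \<equiv> \<Sum>x\<in>items. of_bool (x \<in> V \<phi> h) * ext_marginal x (chosen h) \<phi>"

definition utility_after :: "nat \<Rightarrow> real" where
  "utility_after t = path_mean t (\<lambda>h. f i (chosen h))"

text \<open>The policy \<open>q\<close> reads only the states of its own set \<open>Z\<close>. Its
  choice probabilities therefore stay the same from round to round, and only the function evaluated
  at \<open>Z\<close> changes.\<close>

definition joint_utility :: "(('e, 's) partial_realization \<Rightarrow> 'e option pmf) \<Rightarrow> nat \<Rightarrow> real" where
  "joint_utility q t =
     path_mean t (\<lambda>h \<phi>. run_sum E q \<phi> (card E) (\<lambda>Z. f i (chosen h \<union> Z) \<phi>) {})"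

definition marginal_sum :: "'e set \<Rightarrow> nat \<Rightarrow> real" where
  "marginal_sum S t = path_mean t (\<lambda>h \<phi>. \<Sum>e\<in>S. marginal e (chosen h) \<phi>)"

lemma integrable_in_V:
  fixes X :: "('e, 's) realization \<Rightarrow> real"
  shows "integrable (measure_pmf p) X \<Longrightarrow> integrable (measure_pmf p) (\<lambda>\<phi>. of_bool (x \<in> V \<phi> h) * X \<phi>)"
  by (rule integrable_mult_unit[OF _ weight_in_V])

lemma integrable_ext_marginal:
  "Y \<subseteq> E \<Longrightarrow> x \<in> items \<Longrightarrow> integrable (measure_pmf p) (ext_marginal x Y)"
  by (rule le_given_integrable(1)[OF ext_marginal_gain(1)])

lemma integrable_sum_in_V:
  fixes X :: "'e + nat \<Rightarrow> ('e, 's) realization \<Rightarrow> real"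
  assumes "\<And>x. x \<in> items \<Longrightarrow> integrable (measure_pmf p) (X x)"
  shows "integrable (measure_pmf p) (\<lambda>\<phi>. \<Sum>x\<in>items. of_bool (x \<in> V \<phi> h) * X x \<phi>)"
  by (intro Bochner_Integration.integrable_sum integrable_in_V assms)

lemma integrable_run_sum_union:
  "Y \<subseteq> E \<Longrightarrow> integrable (measure_pmf p) (\<lambda>\<phi>. run_sum E q \<phi> n (\<lambda>Z. f i (Y \<union> Z) \<phi>) {})"
  by (rule integrable_run_sum) (auto intro: integrable_utility)

text \<open>Membership in the candidate set is decided by the states on \<open>chosen h\<close>, so
  its indicator is a weight and the actual gain may be replaced by its conditional
  expectation.\<close>

lemma utility_after_Suc:
  assumes "t < k"
  shows "utility_after (Suc t) = utility_after t + 1 / real (r t) * path_mean t gain"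
proof -
  let ?d = "\<lambda>h \<phi>. \<Sum>x\<in>items. of_bool (x \<in> V \<phi> h) * (f i (chosen h \<union> real_items {x}) \<phi> - f i (chosen h) \<phi>)"
  have le: "le_given (chosen h) (?d h) (gain h)" "le_given (chosen h) (gain h) (?d h)"
    if "h \<in> histories items t" for h
    by (intro le_given_sum le_given_weight[OF _ weight_in_V] ext_marginal_gain chosen_subset[OF that];
        assumption)+
  have "utility_after (Suc t)
      = path_mean t (\<lambda>h \<phi>. f i (chosen h) \<phi> + 1 / real (r t) * ?d h \<phi>)"
    unfolding utility_after_def path_mean_Suc[OF assms]
  proof (rule path_mean_cong)
    fix h \<phi> assume h: "h \<in> histories items t" and \<phi>: "\<phi> \<in> set_pmf p"
    show "1 / real (r t) * (\<Sum>x\<in>items. of_bool (x \<in> V \<phi> h) * f i (chosen (x # h)) \<phi>)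
        = f i (chosen h) \<phi> + 1 / real (r t) * ?d h \<phi>"
      unfolding sum_in_V[OF \<phi> h assms] chosen_Cons
      using r_pos[OF assms] V_card[OF \<phi> h assms] by (simp add: sum_subtractf field_simps)
  qed
  also have "\<dots> = utility_after t + 1 / real (r t) * path_mean t ?d"
    unfolding utility_after_def path_mean_cmult[symmetric]
    by (rule path_mean_add)
      (auto intro!: integrable_utility chosen_subset le_given_integrable(1)[OF le(1)])
  also have "path_mean t ?d = path_mean t gain"
    by (intro antisym path_mean_mono le)
  finally show ?thesis .
qed

lemma utility_after_nonneg: "0 \<le> utility_after t"
  unfolding utility_after_def path_mean_def
  by (intro expectation_nonneg sum_nonneg mult_nonneg_nonneg path_weight_nonneg utility_nonneg chosen_subset)

lemma joint_utility_nonneg: "0 \<le> joint_utility q t"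
proof -
  have "joint_utility q t = (\<Sum>h\<in>histories items t. Ex (\<lambda>\<phi>. path_weight (V \<phi>) h
      * run_sum E q \<phi> (card E) (\<lambda>Z. f i (chosen h \<union> Z) \<phi>) {}))"
    unfolding joint_utility_def
    by (rule path_mean_eq_sum) (intro integrable_run_sum_union chosen_subset)
  also have "\<dots> \<ge> 0"
  proof (intro sum_nonneg)
    fix h assume h: "h \<in> histories items t"
    show "0 \<le> Ex (\<lambda>\<phi>. path_weight (V \<phi>) h * run_sum E q \<phi> (card E) (\<lambda>Z. f i (chosen h \<union> Z) \<phi>) {})"
      by (rule run_sum_nonneg[where F = "\<lambda>Z. f i (chosen h \<union> Z)" and Y = "chosen h"])
        (use chosen_subset[OF h] weight_path_weight in
          \<open>auto intro!: integrable_utility expectation_nonneg mult_nonneg_nonneg utility_nonneg dest: unit_weightD(1)\<close>)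
  qed
  finally show ?thesis .
qed

text \<open>
  Adding all of \<open>U\<close> to \<open>Y\<close> leaves a nonnegative utility, so by subadditivity the marginals of
  the items in \<open>U\<close> add up to at least minus the utility of \<open>Y\<close>.
\<close>

lemma expectation_add_in_V_ge:
  assumes h: "h \<in> histories items t" and t: "t < k" and Y: "chosen h \<subseteq> Y" "Y \<subseteq> E" and W: "weight Y W"
  shows "(real (r t) - 1) * Ex (\<lambda>\<phi>. W \<phi> * f i Y \<phi>)
    \<le> Ex (\<lambda>\<phi>. W \<phi> * (\<Sum>x\<in>items. of_bool (x \<in> V \<phi> h) * f i (Y \<union> real_items {x}) \<phi>))"
proof -
  define G where "G = (\<lambda>U \<phi>. \<Sum>x\<in>U. f i (Y \<union> real_items {x}) \<phi> - f i Y \<phi>)"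
  \<comment> \<open>The candidate set varies with the states, while subadditivity concerns a fixed
    set. Splitting by the value \<open>U\<close> fixes it, and the indicator of each case is a
    weight because \<open>chosen h \<subseteq> Y\<close>.\<close>
  define W' where "W' = (\<lambda>U \<phi>. W \<phi> * of_bool (V \<phi> h = U))"
  have sub: "Y \<union> real_items U \<subseteq> E" if "U \<subseteq> items" for U
    using real_items_subset[OF that] Y by auto
  have W': "weight Y (W' U)" for U
    unfolding W'_def
    by (intro weight_mult[OF W] weight_mono[OF weight_of_bool Y(1)]) (use V_observe in metis)
  have int: "integrable (measure_pmf p) (\<lambda>\<phi>. W' U \<phi> * X \<phi>)" if "integrable (measure_pmf p) X" for U X
    using that W' by (rule integrable_mult_unit)
  have intG: "integrable (measure_pmf p) (G U)" if "U \<subseteq> items" for U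
    unfolding G_def using that Y(2) by (intro Bochner_Integration.integrable_sum integrable_gain sub) auto
  have ge: "0 \<le> Ex (\<lambda>\<phi>. W' U \<phi> * (G U \<phi> + f i Y \<phi>))" if U: "U \<subseteq> items" for U
  proof -
    have "0 \<le> Ex (\<lambda>\<phi>. W' U \<phi> * f i (Y \<union> real_items U) \<phi>)"
      by (intro expectation_nonneg mult_nonneg_nonneg utility_nonneg sub U unit_weightD(1)[OF W'])
    also have "\<dots> = Ex (\<lambda>\<phi>. W' U \<phi> * (f i (Y \<union> real_items U) \<phi> - f i Y \<phi>)) + Ex (\<lambda>\<phi>. W' U \<phi> * f i Y \<phi>)"
      by (subst Bochner_Integration.integral_add[symmetric])
        (auto intro!: int integrable_gain integrable_utility sub U Y simp: algebra_simps)
    also have "\<dots> \<le> Ex (\<lambda>\<phi>. W' U \<phi> * G U \<phi>) + Ex (\<lambda>\<phi>. W' U \<phi> * f i Y \<phi>)"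
      unfolding G_def by (intro add_right_mono le_givenD[OF gain_subadditive[OF U Y(2)] W'])
    also have "\<dots> = Ex (\<lambda>\<phi>. W' U \<phi> * (G U \<phi> + f i Y \<phi>))"
      unfolding distrib_left
      by (rule Bochner_Integration.integral_add[symmetric]) (intro int intG integrable_utility U Y)+
    finally show ?thesis .
  qed
  have "0 \<le> (\<Sum>U\<in>Pow items. Ex (\<lambda>\<phi>. W' U \<phi> * (G U \<phi> + f i Y \<phi>)))"
    by (intro sum_nonneg ge) auto
  also have "\<dots> = Ex (\<lambda>\<phi>. \<Sum>U\<in>Pow items. W' U \<phi> * (G U \<phi> + f i Y \<phi>))"
    by (rule Bochner_Integration.integral_sum[symmetric])
      (intro int Bochner_Integration.integrable_add intG integrable_utility Y, auto)
  also have "\<dots> = Ex (\<lambda>\<phi>. W \<phi> * (\<Sum>x\<in>items. of_bool (x \<in> V \<phi> h) * f i (Y \<union> real_items {x}) \<phi>)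
      - (real (r t) - 1) * (W \<phi> * f i Y \<phi>))"
  proof (rule expectation_cong)
    fix \<phi> assume \<phi>: "\<phi> \<in> set_pmf p"
    have "(\<Sum>U\<in>Pow items. W' U \<phi> * (G U \<phi> + f i Y \<phi>)) = (\<Sum>U\<in>{V \<phi> h}. W' U \<phi> * (G U \<phi> + f i Y \<phi>))"
      by (rule sum.mono_neutral_right) (use V_subset[OF \<phi> h t] finite_items in \<open>auto simp: W'_def\<close>)
    also have "\<dots> = W \<phi> * (G (V \<phi> h) \<phi> + f i Y \<phi>)"
      by (simp add: W'_def)
    \<comment> \<open>\<open>G\<close> subtracts the utility of \<open>Y\<close> once per candidate
      and one copy is added back, which leaves the factor \<open>r t - 1\<close>.\<close>
    also have "\<dots> = W \<phi> * (\<Sum>x\<in>items. of_bool (x \<in> V \<phi> h) * f i (Y \<union> real_items {x}) \<phi>)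
        - (real (r t) - 1) * (W \<phi> * f i Y \<phi>)"
      unfolding sum_in_V[OF \<phi> h t] G_def
      using V_card[OF \<phi> h t] by (simp add: sum_subtractf algebra_simps)
    finally show "(\<Sum>U\<in>Pow items. W' U \<phi> * (G U \<phi> + f i Y \<phi>))
      = W \<phi> * (\<Sum>x\<in>items. of_bool (x \<in> V \<phi> h) * f i (Y \<union> real_items {x}) \<phi>)
        - (real (r t) - 1) * (W \<phi> * f i Y \<phi>)" .
  qed
  also have "\<dots> = Ex (\<lambda>\<phi>. W \<phi> * (\<Sum>x\<in>items. of_bool (x \<in> V \<phi> h) * f i (Y \<union> real_items {x}) \<phi>))
      - (real (r t) - 1) * Ex (\<lambda>\<phi>. W \<phi> * f i Y \<phi>)"
    by (subst Bochner_Integration.integral_diff)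
      (auto intro!: integrable_mult_unit[OF _ W] integrable_sum_in_V integrable_utility sub Y)
  finally show ?thesis by simp
qed

text \<open>The one-round bound holds at every union \<open>chosen h \<union> Z\<close> that the
  policy can reach, given the states on all of it. Linearity of \<open>run_sum\<close> carries it
  through the run.\<close>

lemma joint_utility_Suc:
  assumes t: "t < k"
  shows "(1 - 1 / real (r t)) * joint_utility q t \<le> joint_utility q (Suc t)"
proof -
  let ?J = "\<lambda>Y \<phi>. run_sum E q \<phi> (card E) (\<lambda>Z. f i (Y \<union> Z) \<phi>) {}"
  have "le_given (chosen h) (\<lambda>\<phi>. (1 - 1 / real (r t)) * ?J (chosen h) \<phi>)
     (\<lambda>\<phi>. 1 / real (r t) * (\<Sum>x\<in>items. of_bool (x \<in> V \<phi> h) * ?J (chosen (x # h)) \<phi>))"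
    if h: "h \<in> histories items t" for h
  proof -
    \<comment> \<open>The surplus over the retained share at a fixed \<open>Z\<close>; its sign is
      known only in conditional expectation, which is what \<open>run_sum_nonneg\<close> asks
      for.\<close>
    define F where "F = (\<lambda>Z \<phi>. (\<Sum>x\<in>items. of_bool (x \<in> V \<phi> h) * f i (chosen (x # h) \<union> Z) \<phi>)
      - (real (r t) - 1) * f i (chosen h \<union> Z) \<phi>)"
    have int: "integrable (measure_pmf p) (\<lambda>\<phi>. \<Sum>x\<in>items. of_bool (x \<in> V \<phi> h) * f i (chosen (x # h) \<union> Z) \<phi>)"
      "integrable (measure_pmf p) (f i (chosen h \<union> Z))" if "Z \<subseteq> E" for Z
      using that chosen_Cons_subset[OF h] chosen_subset[OF h]
      by (auto intro!: integrable_sum_in_V integrable_utility simp del: list.set)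
    have intF: "integrable (measure_pmf p) (F Z)" if "Z \<subseteq> E" for Z
      unfolding F_def using int[OF that] by simp
    have ge: "0 \<le> Ex (\<lambda>\<phi>. W \<phi> * F Z \<phi>)" if "Z \<subseteq> E" "weight (chosen h \<union> Z) W" for Z W
    proof -
      have Y: "chosen h \<subseteq> chosen h \<union> Z" "chosen h \<union> Z \<subseteq> E"
        using chosen_subset[OF h] that(1) by auto
      have "Ex (\<lambda>\<phi>. W \<phi> * F Z \<phi>)
        = Ex (\<lambda>\<phi>. W \<phi> * (\<Sum>x\<in>items. of_bool (x \<in> V \<phi> h) * f i (chosen (x # h) \<union> Z) \<phi>)
            - (real (r t) - 1) * (W \<phi> * f i (chosen h \<union> Z) \<phi>))"
        by (simp add: F_def right_diff_distrib mult.left_commute)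
      also have "\<dots> = Ex (\<lambda>\<phi>. W \<phi> * (\<Sum>x\<in>items. of_bool (x \<in> V \<phi> h) * f i (chosen (x # h) \<union> Z) \<phi>))
            - (real (r t) - 1) * Ex (\<lambda>\<phi>. W \<phi> * f i (chosen h \<union> Z) \<phi>)"
        by (subst Bochner_Integration.integral_diff)
          (auto intro!: integrable_mult_unit[OF _ that(2)] int that(1) simp del: list.set)
      also have "\<dots> \<ge> 0"
        using expectation_add_in_V_ge[OF h t Y that(2)] by (simp add: chosen_Cons Un_ac del: list.set)
      finally show ?thesis .
    qed
    have nonneg: "0 \<le> Ex (\<lambda>\<phi>. W \<phi> * run_sum E q \<phi> (card E) (\<lambda>Z. F Z \<phi>) {})"
      if "weight (chosen h) W" for W
      by (rule run_sum_nonneg[where Y = "chosen h" and F = F]) (use that ge intF in auto)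
    have "run_sum E q \<phi> (card E) (\<lambda>Z. F Z \<phi>) {}
      = (\<Sum>x\<in>items. of_bool (x \<in> V \<phi> h) * ?J (chosen (x # h)) \<phi>) - (real (r t) - 1) * ?J (chosen h) \<phi>" for \<phi>
      by (simp add: F_def run_sum_diff run_sum_sum run_sum_cmult)
    note nonneg = nonneg[unfolded this]
    have int': "integrable (measure_pmf p) (\<lambda>\<phi>. \<Sum>x\<in>items. of_bool (x \<in> V \<phi> h) * ?J (chosen (x # h)) \<phi>)"
      "integrable (measure_pmf p) (?J (chosen h))"
      by (auto intro!: integrable_sum_in_V integrable_run_sum_union chosen_Cons_subset[OF h] chosen_subset[OF h]
          simp del: list.set)
    have "le_given (chosen h) (\<lambda>\<phi>. (real (r t) - 1) * ?J (chosen h) \<phi>)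
        (\<lambda>\<phi>. \<Sum>x\<in>items. of_bool (x \<in> V \<phi> h) * ?J (chosen (x # h)) \<phi>)"
      unfolding le_given_def
    proof (intro conjI allI impI)
      fix W :: "('e, 's) realization \<Rightarrow> real" assume W: "weight (chosen h) W"
      have "Ex (\<lambda>\<phi>. W \<phi> * (\<Sum>x\<in>items. of_bool (x \<in> V \<phi> h) * ?J (chosen (x # h)) \<phi>))
          - Ex (\<lambda>\<phi>. W \<phi> * ((real (r t) - 1) * ?J (chosen h) \<phi>)) \<ge> 0"
        using nonneg[OF W] unfolding right_diff_distrib
        by (subst Bochner_Integration.integral_diff[symmetric])
          (auto intro!: integrable_mult_unit[OF _ W] int' simp del: list.set simp: right_diff_distrib)
      then show "Ex (\<lambda>\<phi>. W \<phi> * ((real (r t) - 1) * ?J (chosen h) \<phi>))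
        \<le> Ex (\<lambda>\<phi>. W \<phi> * (\<Sum>x\<in>items. of_bool (x \<in> V \<phi> h) * ?J (chosen (x # h)) \<phi>))" by simp
    qed (use int' in auto)
    from le_given_cmult[OF this, of "1 / real (r t)"] r_pos[OF t] show ?thesis
      by (simp add: field_simps del: list.set)
  qed
  then show ?thesis
    unfolding joint_utility_def path_mean_Suc[OF t] path_mean_cmult[symmetric] by (rule path_mean_mono)
qed

text \<open>The utility of the union minus the marginals at \<open>chosen h\<close> of the policy's
  items is a supermartingale along the run and starts at the utility of \<open>chosen h\<close>. The
  subtracted marginals are then bounded at each realization: \<open>S\<close> is split off, and at
  most \<open>r t\<close> further items compete with the candidates through
  \<open>top\<close>.\<close>

lemma joint_utility_le:
  assumes t: "t < k" and valid: "\<And>\<phi>. \<phi> \<in> set_pmf p \<Longrightarrow> valid_policy_at E (\<pi> i) \<phi>"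
    and S: "S \<subseteq> E"
    and run: "\<And>\<phi> Z. \<phi> \<in> set_pmf p \<Longrightarrow> Z \<in> set_pmf (run \<pi> i \<phi> (card E) {}) \<Longrightarrow> S \<subseteq> Z \<and> card (Z - S) \<le> r t"
    and top: "\<And>h \<phi> T. h \<in> histories items t \<Longrightarrow> \<phi> \<in> set_pmf p \<Longrightarrow> T \<subseteq> E \<Longrightarrow> card T \<le> r t \<Longrightarrow>
      (\<Sum>e\<in>T. marginal e (chosen h) \<phi>) \<le> (\<Sum>x\<in>V \<phi> h. ext_marginal x (chosen h) \<phi>)"
  shows "joint_utility (\<pi> i) t \<le> utility_after t + marginal_sum S t + path_mean t gain"
proof -
  let ?R = "\<lambda>F \<phi>. run_sum E (\<pi> i) \<phi> (card E) F {}"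
  let ?B = "\<lambda>h \<phi>. (\<Sum>e\<in>S. marginal e (chosen h) \<phi>) + gain h \<phi>"
  have intB: "integrable (measure_pmf p) (\<lambda>\<phi>. \<Sum>e\<in>S. marginal e (chosen h) \<phi>)"
    "integrable (measure_pmf p) (gain h)" if h: "h \<in> histories items t" for h
    using S chosen_subset[OF h]
    by (auto intro!: Bochner_Integration.integrable_sum integrable_marginal integrable_sum_in_V integrable_ext_marginal)
  have "le_given (chosen h) (\<lambda>\<phi>. ?R (\<lambda>Z. f i (chosen h \<union> Z) \<phi>) \<phi>) (\<lambda>\<phi>. f i (chosen h) \<phi> + ?B h \<phi>)"
    if h: "h \<in> histories items t" for h
  proof -
    define m where "m = (\<lambda>Z \<phi>. \<Sum>e\<in>Z. marginal e (chosen h) \<phi>)"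
    define F where "F = (\<lambda>Z \<phi>. f i (chosen h \<union> Z) \<phi> - m Z \<phi>)"
    note sub = chosen_subset[OF h]
    have intm: "integrable (measure_pmf p) (m Z)" if "Z \<subseteq> E" for Z
      unfolding m_def using that sub by (auto intro!: Bochner_Integration.integrable_sum integrable_marginal)
    have intF: "integrable (measure_pmf p) (F Z)" if "Z \<subseteq> E" for Z
      unfolding F_def using that sub intm by (auto intro!: Bochner_Integration.integrable_diff integrable_utility)
    have step: "Ex (\<lambda>\<phi>. W \<phi> * F (insert e Z) \<phi>) \<le> Ex (\<lambda>\<phi>. W \<phi> * F Z \<phi>)"
      if Z: "Z \<subseteq> E" and e: "e \<in> E - Z" and W: "weight (chosen h \<union> Z) W" for Z e W
    proof -
      let ?Y = "chosen h \<union> Z"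
      have Y: "?Y \<subseteq> E" using sub Z by auto
      have finZ: "finite Z" using Z finite_E finite_subset by blast
      have le: "Ex (\<lambda>\<phi>. W \<phi> * (f i (insert e ?Y) \<phi> - f i ?Y \<phi>)) \<le> Ex (\<lambda>\<phi>. W \<phi> * marginal e (chosen h) \<phi>)"
      \<comment> \<open>If the greedy path already contains \<open>e\<close>, both the gain and the
        marginal are 0; otherwise adaptive submodularity applies.\<close>
      proof (cases "e \<in> chosen h")
        case True
        then show ?thesis by (simp add: insert_absorb)
      next
        case False
        then show ?thesis using e Y by (intro expectation_gain_le_marginal W) auto
      qed
      have "Ex (\<lambda>\<phi>. W \<phi> * F (insert e Z) \<phi>) = Ex (\<lambda>\<phi>. W \<phi> * F Z \<phi>
          + (W \<phi> * (f i (insert e ?Y) \<phi> - f i ?Y \<phi>) - W \<phi> * marginal e (chosen h) \<phi>))"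
        using e finZ by (simp add: F_def m_def algebra_simps)
      also have "\<dots> = Ex (\<lambda>\<phi>. W \<phi> * F Z \<phi>) + (Ex (\<lambda>\<phi>. W \<phi> * (f i (insert e ?Y) \<phi> - f i ?Y \<phi>))
          - Ex (\<lambda>\<phi>. W \<phi> * marginal e (chosen h) \<phi>))"
      proof -
        have 1: "integrable (measure_pmf p) (\<lambda>\<phi>. W \<phi> * F Z \<phi>)"
          by (intro integrable_mult_unit[OF _ W] intF Z)
        have 2: "integrable (measure_pmf p) (\<lambda>\<phi>. W \<phi> * (f i (insert e ?Y) \<phi> - f i ?Y \<phi>))"
          by (rule integrable_mult_unit[OF integrable_gain W]) (use Y e in auto)
        have 3: "integrable (measure_pmf p) (\<lambda>\<phi>. W \<phi> * marginal e (chosen h) \<phi>)"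
          by (rule integrable_mult_unit[OF integrable_marginal W]) (use sub e in auto)
        show ?thesis
          by (simp only: Bochner_Integration.integral_add[OF 1 Bochner_Integration.integrable_diff[OF 2 3]]
              Bochner_Integration.integral_diff[OF 2 3])
      qed
      finally show ?thesis using le by simp
    qed
    have "le_given (chosen h) (\<lambda>\<phi>. ?R (\<lambda>Z. F Z \<phi>) \<phi>) (f i (chosen h))"
      unfolding le_given_def
    proof (intro conjI allI impI)
      fix W :: "('e, 's) realization \<Rightarrow> real" assume W: "weight (chosen h) W"
      have "Ex (\<lambda>\<phi>. W \<phi> * ?R (\<lambda>Z. F Z \<phi>) \<phi>) \<le> Ex (\<lambda>\<phi>. W \<phi> * F {} \<phi>)"
        by (rule run_sum_supermartingale[where F = F and Y = "chosen h"])
          (use valid intF step W in auto)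
      then show "Ex (\<lambda>\<phi>. W \<phi> * ?R (\<lambda>Z. F Z \<phi>) \<phi>) \<le> Ex (\<lambda>\<phi>. W \<phi> * f i (chosen h) \<phi>)"
        by (simp add: F_def m_def)
    qed (use integrable_run_sum[where F = F, OF intF] integrable_utility sub in auto)
    moreover have "le_given (chosen h) (\<lambda>\<phi>. ?R (\<lambda>Z. m Z \<phi>) \<phi>) (?B h)"
    proof (rule le_given_pointwise)
      fix \<phi> assume \<phi>: "\<phi> \<in> set_pmf p"
      show "?R (\<lambda>Z. m Z \<phi>) \<phi> \<le> ?B h \<phi>"
      proof (rule run_sum_le[where \<pi> = \<pi> and i = i, OF finite_E valid[OF \<phi>]])
        fix Z assume Z: "Z \<in> set_pmf (run \<pi> i \<phi> (card E) {})"
        have "Z \<subseteq> E" using set_run[where \<pi> = \<pi> and i = i, OF valid[OF \<phi>] _ Z] by auto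
        then have "m Z \<phi> = m S \<phi> + m (Z - S) \<phi>"
          unfolding m_def using run[OF \<phi> Z] finite_subset[OF \<open>Z \<subseteq> E\<close> finite_E] sum.subset_diff[of S Z]
          by (simp add: add.commute)
        also have "m (Z - S) \<phi> \<le> gain h \<phi>"
          unfolding sum_in_V[OF \<phi> h t] m_def by (rule top[OF h \<phi>]) (use run[OF \<phi> Z] \<open>Z \<subseteq> E\<close> in auto)
        finally show "m Z \<phi> \<le> ?B h \<phi>" by (simp add: m_def)
      qed simp
    qed (use integrable_run_sum[where F = m, OF intm] intB[OF h] in auto)
    ultimately have "le_given (chosen h) (\<lambda>\<phi>. ?R (\<lambda>Z. F Z \<phi>) \<phi> + ?R (\<lambda>Z. m Z \<phi>) \<phi>) (\<lambda>\<phi>. f i (chosen h) \<phi> + ?B h \<phi>)"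
      by (rule le_given_add)
    then show ?thesis
      by (simp add: run_sum_add[symmetric] F_def)
  qed
  then have "joint_utility (\<pi> i) t \<le> path_mean t (\<lambda>h \<phi>. f i (chosen h) \<phi> + ?B h \<phi>)"
    unfolding joint_utility_def by (rule path_mean_mono)
  also have "\<dots> = utility_after t + (marginal_sum S t + path_mean t gain)"
    unfolding utility_after_def marginal_sum_def
    by (subst path_mean_add; (subst path_mean_add)?)
      (auto intro!: intB integrable_utility chosen_subset Bochner_Integration.integrable_add)
  finally show ?thesis by simp
qed

text \<open>Choosing \<open>x\<close> does not raise the marginals of other items. Its own marginal
  is replaced by 0, which is no increase exactly when it was nonnegative; hence the hypothesis
  \<open>nonneg\<close>.\<close>

lemma marginal_sum_Suc:
  assumes t: "t < k" and S: "S \<subseteq> E"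
    and nonneg: "\<And>h \<phi> e. h \<in> histories items t \<Longrightarrow> \<phi> \<in> set_pmf p \<Longrightarrow> Inl e \<in> V \<phi> h \<Longrightarrow> 0 \<le> marginal e (chosen h) \<phi>"
  shows "marginal_sum S (Suc t) \<le> marginal_sum S t"
proof -
  let ?m = "\<lambda>h \<phi>. \<Sum>e\<in>S. marginal e (chosen h) \<phi>"
  have int: "integrable (measure_pmf p) (?m h)" if "chosen h \<subseteq> E" for h
    using S that by (auto intro!: Bochner_Integration.integrable_sum integrable_marginal)
  have "marginal_sum S (Suc t) \<le> path_mean t (\<lambda>h \<phi>. 1 / real (r t) * (\<Sum>x\<in>items. of_bool (x \<in> V \<phi> h) * ?m h \<phi>))"
    unfolding marginal_sum_def path_mean_Suc[OF t]
  proof (intro path_mean_mono le_given_cmult le_given_pointwise sum_mono integrable_sum_in_V int)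
    fix h \<phi> x assume h: "h \<in> histories items t" and \<phi>: "\<phi> \<in> set_pmf p" and x: "x \<in> items"
    have "marginal e (chosen (x # h)) \<phi> \<le> marginal e (chosen h) \<phi>" if "x \<in> V \<phi> h" "e \<in> S" for e
    proof (cases "e \<in> chosen (x # h)")
      case True
      then have "e \<in> chosen h \<or> x = Inl e" by (auto simp: real_items_def)
      then show ?thesis using nonneg[OF h \<phi>, of e] that(1) marginal_in[OF True]
        by (auto simp del: list.set)
    next
      case False
      then show ?thesis
        using S that(2) chosen_Cons_subset[OF h x]
        by (intro marginal_antimono \<phi>) (auto simp: chosen_Cons simp del: list.set)
    qed
    then show "of_bool (x \<in> V \<phi> h) * ?m (x # h) \<phi> \<le> of_bool (x \<in> V \<phi> h) * ?m h \<phi>"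
      by (auto intro!: sum_mono simp del: list.set)
  qed (use chosen_subset chosen_Cons_subset in auto)
  also have "\<dots> = marginal_sum S t"
    unfolding marginal_sum_def
  proof (rule path_mean_cong)
    fix h \<phi> assume "h \<in> histories items t" "\<phi> \<in> set_pmf p"
    then show "1 / real (r t) * (\<Sum>x\<in>items. of_bool (x \<in> V \<phi> h) * ?m h \<phi>) = ?m h \<phi>"
      using V_card[of \<phi> h t] r_pos t by (simp add: sum_in_V)
  qed
  finally show ?thesis .
qed

end

section \<open>Top sets and the distribution of the greedy policy\<close>

text \<open>The sequence increases, starting from 1/4 at \<open>n = 2\<close>.\<close>

lemma one_minus_inverse_power_ge:
  assumes "2 \<le> n"
  shows "1 / 4 \<le> (1 - 1 / real n) ^ n"
  using assms
proof (induction n rule: nat_induct_at_least)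
  case base
  show ?case by (simp add: power2_eq_square)
next
  case (Suc n)
  define x where "x = real n"
  have x: "x \<ge> 2" using Suc.hyps by (simp add: x_def)
  have x2: "x * x > 1" using x by (intro less_1_mult) auto
  \<comment> \<open>Bernoulli's inequality for the ratio of consecutive bases: (1 - 1/(x+1)) / (1 -
    1/x) equals \<open>1 + 1 / (x\<^sup>2 - 1)\<close>.\<close>
  have "1 + real (Suc n) * (1 / (x\<^sup>2 - 1)) \<le> (1 + 1 / (x\<^sup>2 - 1)) ^ Suc n"
    by (rule Bernoulli_inequality) (use x power2_less_imp_less[of 1 x] in \<open>auto simp: field_simps one_le_power\<close>)
  moreover have "1 + real (Suc n) * (1 / (x\<^sup>2 - 1)) = x / (x - 1)"
    using x x2 by (simp add: x_def[symmetric] power2_eq_square divide_simps) (simp add: algebra_simps)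
  moreover have "1 + 1 / (x\<^sup>2 - 1) = (1 - 1 / (x + 1)) / (1 - 1 / x)"
    using x x2 by (simp add: power2_eq_square divide_simps) (simp add: algebra_simps)
  ultimately have "x / (x - 1) \<le> (1 - 1 / (x + 1)) ^ Suc n / (1 - 1 / x) ^ Suc n"
    by (simp only: power_divide)
  then have "x / (x - 1) * (1 - 1 / x) ^ Suc n \<le> (1 - 1 / (x + 1)) ^ Suc n"
    using x by (simp add: pos_le_divide_eq)
  also have "x / (x - 1) * (1 - 1 / x) ^ Suc n = (1 - 1 / x) ^ n"
    using x by (simp add: field_simps)
  finally have "(1 - 1 / x) ^ n \<le> (1 - 1 / (x + 1)) ^ Suc n" .
  with Suc.IH[folded x_def] have "1 / 4 \<le> (1 - 1 / (x + 1)) ^ Suc n" by (rule order_trans)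
  moreover have "real (Suc n) = x + 1" by (simp add: x_def)
  ultimately show ?case by (simp only:)
qed

text \<open>A negative member would be beaten by every element of \<open>D\<close>, so
  \<open>U\<close> would contain all of \<open>D\<close> and that member besides, more than
  \<open>r\<close> elements.\<close>

lemma top_set_nonneg:
  fixes g :: "'a \<Rightarrow> real"
  assumes "finite A" "top_set A r g U" "D \<subseteq> A" "r \<le> card D" "\<And>d. d \<in> D \<Longrightarrow> g d = 0" "x \<in> U"
  shows "0 \<le> g x"
proof (rule ccontr)
  assume neg: "\<not> 0 \<le> g x"
  have U: "U \<subseteq> A" "card U = r" "\<And>x y. x \<in> U \<Longrightarrow> y \<in> A - U \<Longrightarrow> g y \<le> g x"
    using assms(2) by (auto simp: top_set_def)
  have "D \<subseteq> U"
  proof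
    fix d assume "d \<in> D"
    with assms(3,5,6) neg U(3)[of x d] show "d \<in> U" by fastforce
  qed
  moreover have "x \<notin> D" using neg assms(5) by auto
  ultimately have "D \<subset> U" using assms(6) by auto
  then have "card D < card U" using U(1) assms(1) by (intro psubset_card_mono) (auto intro: finite_subset)
  with assms(4) U(2) show False by simp
qed

text \<open>An exchange argument around the least value \<open>m\<close> on \<open>U\<close>:
  elements of \<open>T - U\<close> are worth at most \<open>m\<close>, those of \<open>U - T\<close>
  at least \<open>m\<close>, and there are at least as many of the latter.\<close>

lemma top_set_sum_ge:
  fixes g :: "'a \<Rightarrow> real"
  assumes "finite A" "top_set A r g U" "D \<subseteq> A" "r \<le> card D" "\<And>d. d \<in> D \<Longrightarrow> g d = 0"
    and "T \<subseteq> A" "card T \<le> r"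
  shows "sum g T \<le> sum g U"
proof (cases "U = {}")
  case True
  with assms(2,7) have "card T = 0" by (auto simp: top_set_def)
  moreover have "finite T" using assms(1,6) finite_subset by blast
  ultimately show ?thesis using True by simp
next
  case False
  have U: "U \<subseteq> A" "card U = r" "\<And>x y. x \<in> U \<Longrightarrow> y \<in> A - U \<Longrightarrow> g y \<le> g x"
    using assms(2) by (auto simp: top_set_def)
  have fin: "finite U" "finite T" using U(1) assms(1,6) finite_subset by blast+
  define m where "m = Min (g ` U)"
  have m: "m \<le> g x" if "x \<in> U" for x using that fin by (simp add: m_def)
  have "m \<in> g ` U" unfolding m_def using fin False by (intro Min_in) auto
  then obtain x0 where x0: "x0 \<in> U" "m = g x0" by blast
  \<comment> \<open>With negative \<open>m\<close>, a set smaller than \<open>U\<close> could have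
    the larger sum; the zeros in \<open>D\<close> exclude this.\<close>
  have "0 \<le> m" using top_set_nonneg[OF assms(1-5) x0(1)] x0(2) by simp
  have "sum g (T - U) \<le> real (card (T - U)) * m"
    by (rule sum_bounded_above) (use U(3)[OF x0(1)] x0(2) assms(6) in auto)
  also have "\<dots> \<le> real (card (U - T)) * m"
  proof (rule mult_right_mono[OF _ \<open>0 \<le> m\<close>])
    have "card T = card (T \<inter> U) + card (T - U)" "card U = card (T \<inter> U) + card (U - T)"
      using fin card_Int_Diff[of T U] card_Int_Diff[of U T] by (simp_all add: Int_commute)
    with assms(7) U(2) show "real (card (T - U)) \<le> real (card (U - T))" by simp
  qed
  also have "\<dots> \<le> sum g (U - T)"
    by (rule sum_bounded_below) (use m in auto)
  finally have "sum g (T - U) \<le> sum g (U - T)" .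
  moreover have "sum g T = sum g (T \<inter> U) + sum g (T - U)" "sum g U = sum g (T \<inter> U) + sum g (U - T)"
    using fin sum.Int_Diff[of T g U] sum.Int_Diff[of U g T] by (simp_all add: Int_commute)
  ultimately show ?thesis by simp
qed

text \<open>The \<open>k\<close> dummies serve as the zeros, and \<open>r \<le> k\<close> guarantees
  that there are enough of them.\<close>

lemma top_set_extended_items:
  fixes g :: "'e + nat \<Rightarrow> real"
  assumes "finite E" "top_set (extended_items E k) r g U" "r \<le> k" "\<And>j. g (Inr j) = 0"
  shows "\<And>x. x \<in> U \<Longrightarrow> 0 \<le> g x"
    and "\<And>T. T \<subseteq> E \<Longrightarrow> card T \<le> r \<Longrightarrow> (\<Sum>e\<in>T. g (Inl e)) \<le> sum g U"
proof -
  let ?D = "Inr ` {..<k} :: ('e + nat) set"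
  have D: "?D \<subseteq> extended_items E k" "r \<le> card ?D" "\<And>d. d \<in> ?D \<Longrightarrow> g d = 0"
    using assms(3,4) by (auto simp: extended_items_def card_image)
  note fin = finite_extended_items[OF assms(1)]
  show "0 \<le> g x" if "x \<in> U" for x
    using top_set_nonneg[OF fin assms(2) D that] .
  show "(\<Sum>e\<in>T. g (Inl e)) \<le> sum g U" if "T \<subseteq> E" "card T \<le> r" for T
    using top_set_sum_ge[OF fin assms(2) D, of "Inl ` T"] that
    by (auto simp: sum.reindex card_image subset_eq)
qed

lemma expectation_initialize:
  fixes F :: "('e + nat) list \<Rightarrow> real"
  assumes "finite A" "\<And>t h. t < l \<Longrightarrow> h \<in> histories A t \<Longrightarrow> U1 h \<subseteq> A \<and> U1 h \<noteq> {}"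
  shows "t \<le> l \<Longrightarrow> set_pmf (initialize U1 t) \<subseteq> histories A t"
    and "t \<le> l \<Longrightarrow> measure_pmf.expectation (initialize U1 t) F = (\<Sum>h\<in>histories A t. path_weight U1 h * F h)"
proof -
  have fin: "finite (U1 h)" if "t < l" "h \<in> histories A t" for t h
    using assms that finite_subset by blast
  show set: "set_pmf (initialize U1 t) \<subseteq> histories A t" if "t \<le> l" for t
    using that
  proof (induction t)
    case (Suc t)
    show ?case
    proof
      fix h' assume "h' \<in> set_pmf (initialize U1 (Suc t))"
      then obtain h x where h: "h \<in> histories A t" "x \<in> set_pmf (pmf_of_set (U1 h))" "h' = x # h"
        using Suc by auto
      with fin[of t h] assms(2)[of t h] Suc.prems show "h' \<in> histories A (Suc t)"
        by (auto simp: histories_def)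
    qed
  qed simp
  show "measure_pmf.expectation (initialize U1 t) F = (\<Sum>h\<in>histories A t. path_weight U1 h * F h)" if "t \<le> l"
    using that
  proof (induction t arbitrary: F)
    case (Suc t)
    let ?H = "histories A t"
    have finH: "finite ?H" using assms(1) by (rule finite_histories)
    let ?g = "\<lambda>h. measure_pmf.expectation (map_pmf (\<lambda>e. e # h) (pmf_of_set (U1 h))) F"
    have "measure_pmf.expectation (initialize U1 (Suc t)) F = (\<Sum>h\<in>?H. pmf (initialize U1 t) h * ?g h)"
      unfolding initialize.simps
      by (rule expectation_bind_finite[OF finH set])
        (use Suc.prems assms(2)[of t] fin[of t] in auto)
    also have "\<dots> = measure_pmf.expectation (initialize U1 t) ?g"
      by (subst integral_measure_pmf_real[OF finH]) (use set[of t] Suc.prems in \<open>auto simp: mult.commute\<close>)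
    also have "\<dots> = (\<Sum>h\<in>?H. path_weight U1 h * ?g h)"
      using Suc by simp
    also have "\<dots> = (\<Sum>h\<in>?H. path_weight U1 h * ((\<Sum>x\<in>A. of_bool (x \<in> U1 h) * F (x # h)) / real (card (U1 h))))"
    proof (intro sum.cong refl arg_cong2[where f = "(*)"])
      fix h assume h: "h \<in> ?H"
      have "(\<Sum>x\<in>A. of_bool (x \<in> U1 h) * F (x # h)) = (\<Sum>x\<in>U1 h. F (x # h))"
        by (rule sum.mono_neutral_cong_right) (use assms(1) assms(2)[of t h] Suc.prems h in auto)
      then show "?g h = (\<Sum>x\<in>A. of_bool (x \<in> U1 h) * F (x # h)) / real (card (U1 h))"
        using assms(2)[of t h] fin[of t h] Suc.prems h by (simp add: integral_pmf_of_set)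
    qed
    also have "\<dots> = (\<Sum>h\<in>histories A (Suc t). path_weight U1 h * F h)"
      by (rule sum_path_weight_Suc[OF assms(1), symmetric])
    finally show ?case .
  qed simp
qed

text \<open>\<open>execute\<close> unfolds from its first round and \<open>path_weight\<close> from
  its last. Averaging over all histories of length \<open>t\<close> lets the induction move one
  round from the former to the latter.\<close>

lemma expectation_execute:
  fixes F :: "('e + nat) list \<Rightarrow> real"
  assumes "finite A"
    and V: "\<And>t h. l \<le> t \<Longrightarrow> t < k \<Longrightarrow> h \<in> histories A t \<Longrightarrow>
      V h = U2 i h (observe \<phi> (real_items (set h))) \<and> V h \<subseteq> A \<and> V h \<noteq> {}"
  shows "l \<le> t \<Longrightarrow> t + n \<le> k \<Longrightarrow> h \<in> histories A t \<Longrightarrow> set_pmf (execute U2 i \<phi> n h) \<subseteq> histories A (t + n)"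
    and "l \<le> t \<Longrightarrow> t + n \<le> k \<Longrightarrow>
      (\<Sum>h\<in>histories A t. path_weight V h * measure_pmf.expectation (execute U2 i \<phi> n h) F)
      = (\<Sum>h\<in>histories A (t + n). path_weight V h * F h)"
proof -
  have fin: "finite (V h)" if "l \<le> t" "t < k" "h \<in> histories A t" for t h
    using assms(1) V[OF that] finite_subset by blast
  have execute_Suc: "execute U2 i \<phi> (Suc n) h = bind_pmf (pmf_of_set (V h)) (\<lambda>e. execute U2 i \<phi> n (e # h))"
    if "l \<le> t" "t < k" "h \<in> histories A t" for t h n
    using V[OF that] by simp
  have Cons: "x # h \<in> histories A (Suc t)" if "l \<le> t" "t < k" "h \<in> histories A t" "x \<in> V h" for t h x
    using V[OF that(1-3)] that(3,4) by (auto simp: histories_def)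
  show set: "set_pmf (execute U2 i \<phi> n h) \<subseteq> histories A (t + n)"
    if "l \<le> t" "t + n \<le> k" "h \<in> histories A t" for t n h
    using that
  proof (induction n arbitrary: t h)
    case (Suc n)
    then have t: "l \<le> t" "t < k" "h \<in> histories A t" by auto
    have "set_pmf (execute U2 i \<phi> n (x # h)) \<subseteq> histories A (t + Suc n)" if "x \<in> V h" for x
      using Suc.IH[of "Suc t" "x # h"] Suc.prems Cons[OF t that] by simp
    moreover have "set_pmf (pmf_of_set (V h)) = V h"
      using V[OF t] fin[OF t] by (intro set_pmf_of_set) auto
    ultimately show ?case
      unfolding execute_Suc[OF t] set_bind_pmf by blast
  qed simp
  show "(\<Sum>h\<in>histories A t. path_weight V h * measure_pmf.expectation (execute U2 i \<phi> n h) F)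
      = (\<Sum>h\<in>histories A (t + n). path_weight V h * F h)" if "l \<le> t" "t + n \<le> k"
    using that
  proof (induction n arbitrary: t)
    case (Suc n)
    let ?e = "\<lambda>h. measure_pmf.expectation (execute U2 i \<phi> n h) F"
    have "(\<Sum>h\<in>histories A t. path_weight V h * measure_pmf.expectation (execute U2 i \<phi> (Suc n) h) F)
        = (\<Sum>h\<in>histories A t. path_weight V h * ((\<Sum>x\<in>A. of_bool (x \<in> V h) * ?e (x # h)) / real (card (V h))))"
    proof (intro sum.cong refl arg_cong2[where f = "(*)"])
      fix h assume "h \<in> histories A t"
      then have t: "l \<le> t" "t < k" "h \<in> histories A t" using Suc.prems by auto
      have "finite (set_pmf (execute U2 i \<phi> n (x # h)))" if "x \<in> V h" for x
        using set[of "Suc t" n "x # h"] Cons[OF t that] Suc.prems finite_histories[OF assms(1)] finite_subset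
        by (metis add_Suc add_Suc_right le_SucI)
      then have "measure_pmf.expectation (execute U2 i \<phi> (Suc n) h) F = (\<Sum>x\<in>V h. ?e (x # h)) / real (card (V h))"
        unfolding execute_Suc[OF t]
        by (subst pmf_expectation_bind_pmf_of_set)
          (use V[OF t] fin[OF t] in \<open>auto simp: divide_inverse mult.commute sum_distrib_left\<close>)
      also have "(\<Sum>x\<in>V h. ?e (x # h)) = (\<Sum>x\<in>A. of_bool (x \<in> V h) * ?e (x # h))"
        by (rule sum.mono_neutral_cong_left) (use assms(1) V[OF t] in auto)
      finally show "measure_pmf.expectation (execute U2 i \<phi> (Suc n) h) F
        = (\<Sum>x\<in>A. of_bool (x \<in> V h) * ?e (x # h)) / real (card (V h))" .
    qed
    also have "\<dots> = (\<Sum>h\<in>histories A (Suc t). path_weight V h * ?e h)"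
      by (rule sum_path_weight_Suc[OF assms(1), symmetric])
    also have "\<dots> = (\<Sum>h\<in>histories A (t + Suc n). path_weight V h * F h)"
      using Suc.IH[of "Suc t"] Suc.prems by simp
    finally show ?case .
  qed simp
qed

lemma path_weight_cong:
  "(\<And>h'. length h' < length h \<Longrightarrow> V h' = V' h') \<Longrightarrow> path_weight V h = path_weight V' h"
  by (induction h) auto

lemma expectation_greedy_selected:
  fixes F :: "'e set \<Rightarrow> real"
  assumes "finite A" "l \<le> k"
    and V1: "\<And>h. length h < l \<Longrightarrow> V h = U1 h"
    and V2: "\<And>h. l \<le> length h \<Longrightarrow> V h = U2 i h (observe \<phi> (real_items (set h)))"
    and V: "\<And>t h. t < k \<Longrightarrow> h \<in> histories A t \<Longrightarrow> V h \<subseteq> A \<and> V h \<noteq> {}"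
  shows "measure_pmf.expectation (greedy_selected U1 U2 l k i \<phi>) F
    = (\<Sum>h\<in>histories A k. path_weight V h * F (real_items (set h)))"
proof -
  have U1: "U1 h \<subseteq> A \<and> U1 h \<noteq> {}" if "t < l" "h \<in> histories A t" for t h
    using V[of t h] V1[of h] that assms(2) by (auto simp: histories_def)
  have V2': "V h = U2 i h (observe \<phi> (real_items (set h))) \<and> V h \<subseteq> A \<and> V h \<noteq> {}"
    if "l \<le> t" "t < k" "h \<in> histories A t" for t h
    using V2[of h] V[OF that(2,3)] that by (auto simp: histories_def)
  have init: "set_pmf (initialize U1 l) \<subseteq> histories A l"
    "measure_pmf.expectation (initialize U1 l) F' = (\<Sum>h\<in>histories A l. path_weight U1 h * F' h)" for F'
    by (rule expectation_initialize[where l = l, OF assms(1)]; use U1 in auto)+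
  have finH: "finite (histories A t)" for t using assms(1) by (rule finite_histories)
  let ?g = "\<lambda>h. map_pmf (\<lambda>h'. real_items (set h')) (execute U2 i \<phi> (k - l) h)"
  have "measure_pmf.expectation (greedy_selected U1 U2 l k i \<phi>) F
      = (\<Sum>h\<in>histories A l. pmf (initialize U1 l) h * measure_pmf.expectation (?g h) F)"
    unfolding greedy_selected_def
  proof (rule expectation_bind_finite[OF finH])
    show "set_pmf (initialize U1 l) \<subseteq> histories A l" by (rule init(1))
    fix h assume h: "h \<in> histories A l"
    have "set_pmf (execute U2 i \<phi> (k - l) h) \<subseteq> histories A (l + (k - l))"
      by (rule expectation_execute(1)[where V = V and k = k and l = l, OF assms(1)])
        ((rule V2'; assumption) | simp add: assms(2) h)+
    then show "finite (set_pmf (?g h))" using finH finite_subset by fastforce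
  qed
  also have "\<dots> = measure_pmf.expectation (initialize U1 l) (\<lambda>h. measure_pmf.expectation (?g h) F)"
    by (subst integral_measure_pmf_real[OF finH[of l]]) (use init(1) in \<open>auto simp: mult.commute\<close>)
  also have "\<dots> = (\<Sum>h\<in>histories A l. path_weight U1 h * measure_pmf.expectation (?g h) F)"
    by (rule init(2))
  also have "\<dots> = (\<Sum>h\<in>histories A l. path_weight V h
      * measure_pmf.expectation (execute U2 i \<phi> (k - l) h) (\<lambda>h'. F (real_items (set h'))))"
    by (intro sum.cong refl arg_cong2[where f = "(*)"] path_weight_cong) (auto simp: V1 histories_def)
  also have "\<dots> = (\<Sum>h\<in>histories A (l + (k - l)). path_weight V h * F (real_items (set h)))"
    by (rule expectation_execute(2)[where V = V and k = k and l = l, OF assms(1)])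
      ((rule V2'; assumption) | simp add: assms(2))+
  finally show ?thesis using assms(2) by simp
qed

text \<open>Here \<open>F\<close> is the greedy utility, \<open>B\<close> the marginals of the
  optimal set, \<open>g\<close> the summed marginals of the candidates and \<open>Q\<close> the
  utility of the union. Initialization telescopes to \<open>B t \<le> F l - F 0\<close>, execution
  to \<open>c - F k - (F l - F 0) \<le> F k - F l\<close>. The unknown \<open>F l\<close>
  cancels.\<close>

lemma half_bound:
  fixes F B g Q :: "nat \<Rightarrow> real"
  assumes "0 < l" "l < k"
    and g1: "\<And>t. t < l \<Longrightarrow> g t = real l * (F (Suc t) - F t)"
    and g2: "\<And>t. l \<le> t \<Longrightarrow> t < k \<Longrightarrow> g t = real (k - l) * (F (Suc t) - F t)"
    and g0: "\<And>t. t < k \<Longrightarrow> 0 \<le> g t"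
    and B: "\<And>t. t < k \<Longrightarrow> B (Suc t) \<le> B t" "\<And>t. t < l \<Longrightarrow> B t \<le> g t"
    and Q: "\<And>t. l \<le> t \<Longrightarrow> t < k \<Longrightarrow> Q t \<le> F t + B t + g t" "\<And>t. l \<le> t \<Longrightarrow> t < k \<Longrightarrow> c \<le> Q t"
    and F0: "0 \<le> F 0"
  shows "c \<le> 2 * F k"
proof -
  have F_Suc: "F t \<le> F (Suc t)" if "t < k" for t
    using g0[OF that] g1[of t] g2[of t] that assms(1,2) by (cases "t < l") (auto simp: zero_le_mult_iff)
  have F_k: "F t \<le> F k" if "t \<le> k" for t
    using that by (induction rule: inc_induct) (use F_Suc order_trans in blast)+
  have B_mono: "B t \<le> B s" if "s \<le> t" "t \<le> k" for s t
    using that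
  proof (induction rule: dec_induct)
    case (step n)
    then show ?case using B(1)[of n] by simp
  qed simp
  have Bt: "B t \<le> F l - F 0" if "l \<le> t" "t \<le> k" for t
  proof -
    \<comment> \<open>The late value \<open>B t\<close> is charged to each of the \<open>l\<close>
      initialization rounds, whose gains dominate it because \<open>B\<close> does not
      increase.\<close>
    have "real l * B t = (\<Sum>s<l. B t)" by simp
    also have "\<dots> \<le> (\<Sum>s<l. real l * (F (Suc s) - F s))"
    proof (rule sum_mono)
      fix s assume "s \<in> {..<l}"
      then show "B t \<le> real l * (F (Suc s) - F s)" using B_mono[of s t] B(2)[of s] g1[of s] that by simp
    qed
    also have "\<dots> = real l * (F l - F 0)"
      by (simp add: sum_distrib_left[symmetric] sum_lessThan_telescope)
    finally show ?thesis using assms(1) by simp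
  qed
  have "real (k - l) * (c - F k - (F l - F 0)) = (\<Sum>t=l..<k. c - F k - (F l - F 0))" by simp
  also have "\<dots> \<le> (\<Sum>t=l..<k. real (k - l) * (F (Suc t) - F t))"
  proof (rule sum_mono)
    fix t assume t: "t \<in> {l..<k}"
    then show "c - F k - (F l - F 0) \<le> real (k - l) * (F (Suc t) - F t)"
      using Q[of t] Bt[of t] F_k[of t] g2[of t] by simp
  qed
  also have "\<dots> = real (k - l) * (F k - F l)"
    using assms(2) by (simp add: sum_distrib_left[symmetric] sum_Suc_diff')
  finally have "c - F k - (F l - F 0) \<le> F k - F l" using assms(2) by simp
  with F0 show ?thesis by simp
qed

lemma iterated_factor_bound:
  fixes Q :: "nat \<Rightarrow> real"
  assumes "1 < l" "1 < k - l" "0 \<le> Q 0"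
    and Q1: "\<And>t. t < l \<Longrightarrow> (1 - 1 / real l) * Q t \<le> Q (Suc t)"
    and Q2: "\<And>t. l \<le> t \<Longrightarrow> t < k \<Longrightarrow> (1 - 1 / real (k - l)) * Q t \<le> Q (Suc t)"
    and "l \<le> t" "t < k"
  shows "1 / 16 * Q 0 \<le> Q t"
proof -
  define a b where "a = 1 - 1 / real l" and "b = 1 - 1 / real (k - l)"
  have ab: "0 \<le> a" "0 \<le> b" "b \<le> 1" using assms(1,2) by (auto simp: a_def b_def)
  have Qa: "a ^ t * Q 0 \<le> Q t" if "t \<le> l" for t
    using that
  proof (induction t)
    case (Suc t)
    then have "a * (a ^ t * Q 0) \<le> a * Q t" using ab by (intro mult_left_mono) auto
    with Q1[of t] Suc.prems show ?case by (simp add: a_def)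
  qed simp
  have Qb: "b ^ n * Q l \<le> Q (l + n)" if "l + n \<le> k" for n
    using that
  proof (induction n)
    case (Suc n)
    then have "b * (b ^ n * Q l) \<le> b * Q (l + n)" using ab by (intro mult_left_mono) auto
    with Q2[of "l + n"] Suc.prems show ?case by (simp add: b_def)
  qed simp
  have a: "1 / 4 \<le> a ^ l" unfolding a_def by (rule one_minus_inverse_power_ge) (use assms(1) in simp)
  have "1 / 4 \<le> b ^ (k - l)" unfolding b_def by (rule one_minus_inverse_power_ge) (use assms(2) in simp)
  \<comment> \<open>Execution may be unfinished at \<open>t\<close>; fewer factors below 1 only
    help.\<close>
  also have "\<dots> \<le> b ^ (t - l)" using ab assms(7) by (intro power_decreasing) auto
  finally have b: "1 / 4 \<le> b ^ (t - l)" .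
  have l: "1 / 4 * Q 0 \<le> Q l" using mult_right_mono[OF a assms(3)] Qa[of l] by simp
  then have "0 \<le> Q l" using assms(3) by simp
  then have "1 / 4 * Q l \<le> Q t"
    using mult_right_mono[OF b, of "Q l"] Qb[of "t - l"] assms(6,7) by simp
  with l show ?thesis by simp
qed

context greedy_task
begin

text \<open>For the initialization: its candidates ignore the states, so path probabilities are
  constants and leave the expectation. Different tasks can then be added along the same
  history.\<close>

lemma path_mean_nonadaptive:
  assumes "\<And>\<phi> h. length h < t \<Longrightarrow> V \<phi> h = U h"
    and "\<And>h. h \<in> histories items t \<Longrightarrow> integrable (measure_pmf p) (F h)"
  shows "path_mean t F = (\<Sum>h\<in>histories items t. path_weight U h * Ex (F h))"
proof -
  have "path_weight (V \<phi>) h = path_weight U h" if "h \<in> histories items t" for \<phi> h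
    by (rule path_weight_cong) (use assms(1) that in \<open>auto simp: histories_def\<close>)
  moreover have "path_mean t F = (\<Sum>h\<in>histories items t. Ex (\<lambda>\<phi>. path_weight (V \<phi>) h * F h \<phi>))"
    using assms(2) by (rule path_mean_eq_sum)
  ultimately show ?thesis by simp
qed

lemma expectation_ext_marginal:
  assumes "Y \<subseteq> E" "x \<in> items"
  shows "Ex (ext_marginal x Y) = expected_utility p f i (Y \<union> real_items {x}) - expected_utility p f i Y"
proof -
  have sub: "Y \<union> real_items {x} \<subseteq> E" using assms real_items_subset[of "{x}" E k] by auto
  have "Ex (ext_marginal x Y) = Ex (\<lambda>\<phi>. f i (Y \<union> real_items {x}) \<phi> - f i Y \<phi>)"
    using le_givenD[OF ext_marginal_gain(1)[OF assms] weight_one]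
      le_givenD[OF ext_marginal_gain(2)[OF assms] weight_one] by simp
  also have "\<dots> = Ex (f i (Y \<union> real_items {x})) - Ex (f i Y)"
    by (rule Bochner_Integration.integral_diff[OF integrable_utility[OF sub] integrable_utility[OF assms(1)]])
  finally show ?thesis unfolding expected_utility_def .
qed

end

section \<open>The two-phase policy\<close>

locale two_phase =
  fixes E :: "'e set" and p :: "('e, 's) realization pmf" and f :: "('g, 'e, 's) utility"
    and G M :: "'g set" and l k :: nat
    and U1 :: "('e + nat) list \<Rightarrow> ('e + nat) set"
    and U2 :: "'g \<Rightarrow> ('e + nat) list \<Rightarrow> ('e, 's) partial_realization \<Rightarrow> ('e + nat) set"
  assumes M: "M \<subseteq> G" "finite M" "M \<noteq> {}"
    and l: "1 < l" and k: "1 < k - l"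
    and adaptive_task: "i \<in> M \<Longrightarrow> adaptive_task E p f i"
    and U1: "initial_rule E p f M l k U1"
    and U2: "execution_rule E p f G l k U2"
begin

text \<open>Switching by the length of the history turns both phases into one sampling rule, so the
  single-task analysis covers the whole path.\<close>

definition V :: "'g \<Rightarrow> ('e, 's) realization \<Rightarrow> ('e + nat) list \<Rightarrow> ('e + nat) set" where
  "V i \<phi> h = (if length h < l then U1 h else U2 i h (observe \<phi> (real_items (set h))))"

definition r :: "nat \<Rightarrow> nat" where
  "r t = (if t < l then l else k - l)"

abbreviation A :: "('e + nat) set" where "A \<equiv> extended_items E k"

lemma finite_E: "finite E"
proof -
  obtain i where "i \<in> M" using M(3) by auto
  then show ?thesis by (rule adaptive_task.finite_E[OF adaptive_task])
qed

lemma chosen_subset: "h \<in> histories A t \<Longrightarrow> chosen h \<subseteq> E"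
  using real_items_subset by (auto simp: histories_def)

lemma top_U1:
  assumes "h \<in> histories A t" "t < l"
  shows "top_set A l (initial_marginal p f M (set h)) (U1 h)"
  using U1 assms unfolding initial_rule_def histories_def by auto

lemma top_V:
  assumes "i \<in> M" "\<phi> \<in> set_pmf p" "h \<in> histories A t" "l \<le> t" "t < k"
  shows "top_set A (k - l) (extended_marginal p f i (observe \<phi> (chosen h))) (V i \<phi> h)"
proof -
  have "observe \<phi> (chosen h) \<in> partial_realizations E p"
    using assms(2) chosen_subset[OF assms(3)] by (rule observe_in_partial_realizations)
  moreover have "set h \<subseteq> A" "length h = t" using assms(3) by (auto simp: histories_def)
  ultimately show ?thesis
    using U2 M(1) assms unfolding execution_rule_def V_def by auto
qed

lemma V_props:
  assumes "i \<in> M" "\<phi> \<in> set_pmf p" "h \<in> histories A t" "t < k"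
  shows "V i \<phi> h \<subseteq> A" "card (V i \<phi> h) = r t"
proof -
  have len: "length h = t" using assms(3) by (simp add: histories_def)
  have "V i \<phi> h \<subseteq> A \<and> card (V i \<phi> h) = r t"
  proof (cases "t < l")
    case True
    then show ?thesis using top_U1[OF assms(3) True] len by (simp add: V_def r_def top_set_def)
  next
    case False
    then show ?thesis using top_V[OF assms(1-3) _ assms(4)] by (simp add: r_def top_set_def)
  qed
  then show "V i \<phi> h \<subseteq> A" "card (V i \<phi> h) = r t" by auto
qed

lemma greedy_task:
  assumes "i \<in> M"
  shows "greedy_task E p f i (V i) k r"
  unfolding greedy_task_def greedy_task_axioms_def
proof (intro conjI allI impI adaptive_task assms)
  have "l < k" using k by linarith
  then show "0 < r t" for t using l by (simp add: r_def)
qed (use V_props[OF assms] in \<open>auto simp: V_def\<close>)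

lemma greedy_value:
  assumes "i \<in> M"
  shows "f_avg_task p f (greedy_selected U1 U2 l k) i = greedy_task.utility_after E p f i (V i) k k"
proof -
  interpret greedy_task E p f i "V i" k r using assms by (rule greedy_task)
  have "measure_pmf.expectation (greedy_selected U1 U2 l k i \<phi>) (\<lambda>Y. f i Y \<phi>)
      = (\<Sum>h\<in>histories A k. path_weight (V i \<phi>) h * f i (chosen h) \<phi>)" if \<phi>: "\<phi> \<in> set_pmf p" for \<phi>
  proof (rule expectation_greedy_selected[OF finite_items])
    fix t h assume t: "t < k" "h \<in> histories A t"
    have "0 < card (V i \<phi> h)" using V_card[OF \<phi> t(2,1)] r_pos[OF t(1)] by simp
    with V_subset[OF \<phi> t(2,1)] show "V i \<phi> h \<subseteq> A \<and> V i \<phi> h \<noteq> {}" by auto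
  qed (use k in \<open>auto simp: V_def\<close>)
  then show ?thesis
    unfolding f_avg_task_def utility_after_def path_mean_def by (rule expectation_cong)
qed

lemma policy_value:
  assumes "i \<in> M" "\<pi> \<in> policies E p G"
  shows "f_avg_task p f (selected E \<pi>) i = greedy_task.joint_utility E p f i (V i) k (\<pi> i) 0"
proof -
  interpret greedy_task E p f i "V i" k r using assms(1) by (rule greedy_task)
  have "measure_pmf.expectation (selected E \<pi> i \<phi>) (\<lambda>Y. f i Y \<phi>)
      = run_sum E (\<pi> i) \<phi> (card E) (\<lambda>Z. f i Z \<phi>) {}" if \<phi>: "\<phi> \<in> set_pmf p" for \<phi>
    unfolding selected_def
    by (rule expectation_run[OF finite_E valid_policy_at_policies[OF assms(2) _ \<phi>]]) (use assms(1) M in auto)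
  then show ?thesis
    unfolding f_avg_task_def joint_utility_def path_mean_def by (intro expectation_cong) simp
qed

section \<open>Marginals and gains summed over the training tasks\<close>

definition total_marginal :: "('e + nat) list \<Rightarrow> 'e + nat \<Rightarrow> real" where
  "total_marginal h x = real (card M) * initial_marginal p f M (set h) x"

lemma total_marginal_eq:
  assumes "h \<in> histories A t" "x \<in> A"
  shows "total_marginal h x
    = (\<Sum>i\<in>M. measure_pmf.expectation p (\<lambda>\<phi>. extended_marginal p f i (observe \<phi> (chosen h)) x))"
proof -
  have "measure_pmf.expectation p (\<lambda>\<phi>. extended_marginal p f i (observe \<phi> (chosen h)) x)
      = expected_utility p f i (real_items (set h \<union> {x})) - expected_utility p f i (chosen h)" if "i \<in> M" for i
  proof -
    interpret greedy_task E p f i "V i" k r using that by (rule greedy_task)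
    have "real_items (set h \<union> {x}) = chosen h \<union> real_items {x}" by (auto simp: real_items_def)
    then show ?thesis using expectation_ext_marginal[OF chosen_subset[OF assms(1)] assms(2)] by simp
  qed
  then show ?thesis
    using M by (simp add: total_marginal_def initial_marginal_def)
qed

lemma total_marginal_top:
  assumes "h \<in> histories A t" "t < l"
  shows "\<And>x. x \<in> U1 h \<Longrightarrow> 0 \<le> total_marginal h x"
    and "\<And>T. T \<subseteq> E \<Longrightarrow> card T \<le> l \<Longrightarrow> (\<Sum>e\<in>T. total_marginal h (Inl e)) \<le> (\<Sum>x\<in>U1 h. total_marginal h x)"
proof -
  have "initial_marginal p f M (set h) (Inr j) = 0" for j
    by (simp add: initial_marginal_def)
  note top = top_set_extended_items[OF finite_E top_U1[OF assms] _ this]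
  show "0 \<le> total_marginal h x" if "x \<in> U1 h" for x
    using top(1) that k by (simp add: total_marginal_def)
  show "(\<Sum>e\<in>T. total_marginal h (Inl e)) \<le> (\<Sum>x\<in>U1 h. total_marginal h x)" if "T \<subseteq> E" "card T \<le> l" for T
    using top(2)[of T] that k unfolding total_marginal_def sum_distrib_left[symmetric]
    by (intro mult_left_mono) auto
qed

text \<open>If \<open>e\<close> is the item just chosen, its total marginal drops to 0 from a value
  that is nonnegative by the ranking. A single task's marginal of \<open>e\<close> may be negative,
  so the claim need not hold task by task.\<close>

lemma total_marginal_Cons_le:
  assumes h: "h \<in> histories A t" and t: "t < l" and x: "x \<in> U1 h" and e: "e \<in> E"
  shows "total_marginal (x # h) (Inl e) \<le> total_marginal h (Inl e)"
proof -
  have xi: "x \<in> A" using top_U1[OF h t] x by (auto simp: top_set_def)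
  have xh: "x # h \<in> histories A (Suc t)" using h xi by (simp add: histories_def)
  have zero: "total_marginal h' (Inl e) = 0" if "e \<in> chosen h'" for h'
    using that by (simp add: total_marginal_def initial_marginal_def insert_absorb)
  show ?thesis
  proof (cases "e \<in> chosen (x # h)")
    case True
    then have "e \<in> chosen h \<or> x = Inl e" by (auto simp: real_items_def)
    then show ?thesis using zero[OF True] zero[of h] total_marginal_top(1)[OF h t x] by auto
  next
    case False
    show ?thesis
      unfolding total_marginal_eq[OF h Inl_in_extended_items[THEN iffD2, OF e]]
        total_marginal_eq[OF xh Inl_in_extended_items[THEN iffD2, OF e]]
    proof (rule sum_mono)
      fix i assume "i \<in> M"
      then interpret greedy_task E p f i "V i" k r by (rule greedy_task)
      show "Ex (ext_marginal (Inl e) (chosen (x # h))) \<le> Ex (ext_marginal (Inl e) (chosen h))"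
        unfolding extended_marginal.simps
        by (intro expectation_mono integrable_marginal marginal_antimono)
          (use e False chosen_subset[OF h] chosen_subset[OF xh] in \<open>auto simp: real_items_def\<close>)
    qed
  qed
qed

abbreviation gain_sum :: "nat \<Rightarrow> real" where
  "gain_sum t \<equiv> \<Sum>i\<in>M. greedy_task.path_mean E p (V i) k t (\<lambda>h \<phi>. \<Sum>x\<in>A.
     of_bool (x \<in> V i \<phi> h) * extended_marginal p f i (observe \<phi> (chosen h)) x)"

abbreviation optimal_marginal_sum :: "'e set \<Rightarrow> nat \<Rightarrow> real" where
  "optimal_marginal_sum S t \<equiv> \<Sum>i\<in>M. greedy_task.marginal_sum E p f i (V i) k S t"

lemma gain_sum_initial:
  assumes "t < l"
  shows "gain_sum t = (\<Sum>h\<in>histories A t. path_weight U1 h * (\<Sum>x\<in>U1 h. total_marginal h x))"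
proof -
  have sub: "U1 h \<subseteq> A" if "h \<in> histories A t" for h
    using top_U1[OF that assms] by (simp add: top_set_def)
  have "greedy_task.path_mean E p (V i) k t (\<lambda>h \<phi>. \<Sum>x\<in>A.
     of_bool (x \<in> V i \<phi> h) * extended_marginal p f i (observe \<phi> (chosen h)) x)
    = (\<Sum>h\<in>histories A t. path_weight U1 h *
        (\<Sum>x\<in>U1 h. measure_pmf.expectation p (\<lambda>\<phi>. extended_marginal p f i (observe \<phi> (chosen h)) x)))"
    if "i \<in> M" for i
  proof -
    interpret greedy_task E p f i "V i" k r using that by (rule greedy_task)
    have "path_mean t gain = (\<Sum>h\<in>histories A t. path_weight U1 h * Ex (gain h))"
    proof (rule path_mean_nonadaptive)
      show "integrable (measure_pmf p) (gain h)" if "h \<in> histories A t" for h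
        by (intro integrable_sum_in_V integrable_ext_marginal chosen_subset[OF that])
    qed (use assms in \<open>simp add: V_def\<close>)
    also have "\<dots> = (\<Sum>h\<in>histories A t. path_weight U1 h * (\<Sum>x\<in>U1 h. Ex (ext_marginal x (chosen h))))"
    proof (intro sum.cong refl arg_cong2[where f = "(*)"])
      fix h assume h: "h \<in> histories A t"
      have "Ex (gain h) = Ex (\<lambda>\<phi>. \<Sum>x\<in>U1 h. ext_marginal x (chosen h) \<phi>)"
      proof (rule expectation_cong)
        fix \<phi> assume "\<phi> \<in> set_pmf p"
        then have "gain h \<phi> = (\<Sum>x\<in>V i \<phi> h. ext_marginal x (chosen h) \<phi>)"
          using h assms k by (intro sum_in_V) auto
        moreover have "V i \<phi> h = U1 h" using h assms by (simp add: V_def histories_def)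
        ultimately show "gain h \<phi> = (\<Sum>x\<in>U1 h. ext_marginal x (chosen h) \<phi>)" by (simp only:)
      qed
      also have "\<dots> = (\<Sum>x\<in>U1 h. Ex (ext_marginal x (chosen h)))"
        by (rule Bochner_Integration.integral_sum)
          (use sub[OF h] chosen_subset[OF h] integrable_ext_marginal in blast)
      finally show "Ex (gain h) = (\<Sum>x\<in>U1 h. Ex (ext_marginal x (chosen h)))" .
    qed
    finally show ?thesis .
  qed
  then have "gain_sum t = (\<Sum>i\<in>M. \<Sum>h\<in>histories A t. path_weight U1 h *
        (\<Sum>x\<in>U1 h. measure_pmf.expectation p (\<lambda>\<phi>. extended_marginal p f i (observe \<phi> (chosen h)) x)))"
    by simp
  also have "\<dots> = (\<Sum>h\<in>histories A t. path_weight U1 h * (\<Sum>x\<in>U1 h. total_marginal h x))"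
    unfolding sum.swap[of _ _ M] sum_distrib_left[symmetric]
    by (intro sum.cong refl arg_cong2[where f = "(*)"] total_marginal_eq[symmetric]) (use sub in auto)
  finally show ?thesis .
qed

text \<open>The case \<open>t = l\<close> is included because a history of that length still
  consists of initialization choices only; the step from round \<open>l - 1\<close> to
  \<open>l\<close> needs it.\<close>

lemma optimal_marginal_sum_initial:
  assumes "t \<le> l" "S \<subseteq> E"
  shows "optimal_marginal_sum S t = (\<Sum>h\<in>histories A t. path_weight U1 h * (\<Sum>e\<in>S. total_marginal h (Inl e)))"
proof -
  have "greedy_task.marginal_sum E p f i (V i) k S t
    = (\<Sum>h\<in>histories A t. path_weight U1 h *
        (\<Sum>e\<in>S. measure_pmf.expectation p (\<lambda>\<phi>. extended_marginal p f i (observe \<phi> (chosen h)) (Inl e))))"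
    if "i \<in> M" for i
  proof -
    interpret greedy_task E p f i "V i" k r using that by (rule greedy_task)
    have int: "integrable (measure_pmf p) (marginal e (chosen h))" if "h \<in> histories A t" "e \<in> S" for h e
      using that chosen_subset assms(2) by (intro integrable_marginal) auto
    have "marginal_sum S t = (\<Sum>h\<in>histories A t. path_weight U1 h * Ex (\<lambda>\<phi>. \<Sum>e\<in>S. marginal e (chosen h) \<phi>))"
      unfolding marginal_sum_def
    proof (rule path_mean_nonadaptive)
      show "integrable (measure_pmf p) (\<lambda>\<phi>. \<Sum>e\<in>S. marginal e (chosen h) \<phi>)" if "h \<in> histories A t" for h
        by (intro Bochner_Integration.integrable_sum int that)
    qed (use assms in \<open>simp add: V_def\<close>)
    also have "\<dots> = (\<Sum>h\<in>histories A t. path_weight U1 h * (\<Sum>e\<in>S. Ex (marginal e (chosen h))))"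
      by (intro sum.cong refl arg_cong2[where f = "(*)"] Bochner_Integration.integral_sum int)
    finally show ?thesis by simp
  qed
  then have "optimal_marginal_sum S t = (\<Sum>i\<in>M. \<Sum>h\<in>histories A t. path_weight U1 h *
        (\<Sum>e\<in>S. measure_pmf.expectation p (\<lambda>\<phi>. extended_marginal p f i (observe \<phi> (chosen h)) (Inl e))))"
    by simp
  also have "\<dots> = (\<Sum>h\<in>histories A t. path_weight U1 h * (\<Sum>e\<in>S. total_marginal h (Inl e)))"
    unfolding sum.swap[of _ _ M] sum_distrib_left[symmetric]
    by (intro sum.cong refl arg_cong2[where f = "(*)"] total_marginal_eq[symmetric]) (use assms in auto)
  finally show ?thesis .
qed

text \<open>\<open>S\<close> has as many items as an initialization round has candidates, so it
  competes with \<open>U1 h\<close> on every initial history.\<close>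

lemma optimal_marginal_sum_le_gain_sum:
  assumes "t < l" "S \<subseteq> E" "card S = l"
  shows "optimal_marginal_sum S t \<le> gain_sum t"
  unfolding optimal_marginal_sum_initial[OF less_imp_le[OF assms(1)] assms(2)] gain_sum_initial[OF assms(1)]
  by (intro sum_mono mult_left_mono path_weight_nonneg total_marginal_top(2)) (use assms in auto)

lemma gain_sum_nonneg:
  assumes "t < k"
  shows "0 \<le> gain_sum t"
proof (cases "t < l")
  case True
  then show ?thesis unfolding gain_sum_initial[OF True]
    by (intro sum_nonneg mult_nonneg_nonneg path_weight_nonneg total_marginal_top(1))
next
  case False
  show ?thesis
  proof (rule sum_nonneg)
    fix i assume i: "i \<in> M"
    interpret greedy_task E p f i "V i" k r using i by (rule greedy_task)
    have ge: "0 \<le> gain h \<phi>" if h: "h \<in> histories A t" and \<phi>: "\<phi> \<in> set_pmf p" for h \<phi>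
      unfolding sum_in_V[OF \<phi> h assms]
      by (intro sum_nonneg top_set_extended_items(1)[OF finite_E top_V[OF i \<phi> h]]) (use False assms in auto)
    show "0 \<le> path_mean t gain"
      unfolding path_mean_def
      by (rule expectation_nonneg, rule sum_nonneg, rule mult_nonneg_nonneg[OF path_weight_nonneg ge])
  qed
qed

text \<open>During initialization totals are compared along the shared path. During execution each
  task has its own top set, whose marginals are nonnegative for that task, so the comparison is made
  separately.\<close>

lemma optimal_marginal_sum_Suc:
  assumes "t < k" "S \<subseteq> E"
  shows "optimal_marginal_sum S (Suc t) \<le> optimal_marginal_sum S t"
proof (cases "t < l")
  case True
  let ?b = "\<lambda>h. \<Sum>e\<in>S. total_marginal h (Inl e)"
  have fin: "finite A" using finite_E by (rule finite_extended_items)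
  have "optimal_marginal_sum S (Suc t) = (\<Sum>h\<in>histories A t. path_weight U1 h
      * ((\<Sum>x\<in>A. of_bool (x \<in> U1 h) * ?b (x # h)) / real (card (U1 h))))"
    using True by (simp add: optimal_marginal_sum_initial assms sum_path_weight_Suc[OF fin])
  also have "\<dots> \<le> (\<Sum>h\<in>histories A t. path_weight U1 h * ?b h)"
  proof (intro sum_mono mult_left_mono path_weight_nonneg)
    fix h assume h: "h \<in> histories A t"
    have U: "U1 h \<subseteq> A" "card (U1 h) = l" using top_U1[OF h True] by (auto simp: top_set_def)
    have "(\<Sum>x\<in>A. of_bool (x \<in> U1 h) * ?b (x # h)) = (\<Sum>x\<in>U1 h. ?b (x # h))"
      by (rule sum.mono_neutral_cong_right) (use fin U in auto)
    also have "\<dots> \<le> (\<Sum>x\<in>U1 h. ?b h)"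
      by (intro sum_mono total_marginal_Cons_le[OF h True]) (use assms(2) in auto)
    finally show "(\<Sum>x\<in>A. of_bool (x \<in> U1 h) * ?b (x # h)) / real (card (U1 h)) \<le> ?b h"
      using l U(2) by (simp add: pos_divide_le_eq mult.commute)
  qed
  also have "\<dots> = optimal_marginal_sum S t" using True by (simp add: optimal_marginal_sum_initial assms)
  finally show ?thesis .
next
  case False
  show ?thesis
  proof (rule sum_mono)
    fix i assume i: "i \<in> M"
    interpret greedy_task E p f i "V i" k r using i by (rule greedy_task)
    show "marginal_sum S (Suc t) \<le> marginal_sum S t"
    proof (rule marginal_sum_Suc[OF assms])
      fix h \<phi> e assume h: "h \<in> histories A t" and \<phi>: "\<phi> \<in> set_pmf p" and e: "Inl e \<in> V i \<phi> h"
      have "l \<le> t" using False by simp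
      from top_set_extended_items(1)[OF finite_E top_V[OF i \<phi> h this assms(1)] _ _ e]
      show "0 \<le> marginal e (chosen h) \<phi>" by simp
    qed
  qed
qed

text \<open>A feasible policy adds at most \<open>k - l\<close> items to \<open>S\<close>, exactly
  the number of candidates in an execution round.\<close>

lemma joint_sum_le:
  assumes t: "l \<le> t" "t < k" and S: "S \<subseteq> E" "card S = l"
    and \<pi>: "\<pi> \<in> Omega_policies E p G S k"
  shows "(\<Sum>i\<in>M. greedy_task.joint_utility E p f i (V i) k (\<pi> i) t)
    \<le> (\<Sum>i\<in>M. greedy_task.utility_after E p f i (V i) k t) + optimal_marginal_sum S t + gain_sum t"
  unfolding sum.distrib[symmetric]
proof (rule sum_mono)
  fix i assume i: "i \<in> M"
  then have iG: "i \<in> G" using M by auto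
  interpret greedy_task E p f i "V i" k r using i by (rule greedy_task)
  have pol: "\<pi> \<in> policies E p G" using \<pi> by (simp add: Omega_policies_def)
  have valid: "valid_policy_at E (\<pi> i) \<phi>" if "\<phi> \<in> set_pmf p" for \<phi>
    using valid_policy_at_policies[OF pol iG that] .
  have rt: "r t = k - l" using t by (simp add: r_def)
  show "joint_utility (\<pi> i) t \<le> utility_after t + marginal_sum S t + path_mean t gain"
  proof (rule joint_utility_le[where \<pi> = \<pi>, OF t(2) valid S(1)])
    fix \<phi> Z assume \<phi>: "\<phi> \<in> set_pmf p" and Z: "Z \<in> set_pmf (run \<pi> i \<phi> (card E) {})"
    have first: "run \<pi> i \<phi> (card S) {} = return_pmf S" and card: "card Z \<le> k"
      using \<pi> iG \<phi> Z by (auto simp: Omega_policies_def selected_def)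
    have finS: "finite S" using S(1) finite_E finite_subset by blast
    \<comment> \<open>This splits the \<open>card E\<close> steps of the full run into the first
      \<open>card S\<close> forced ones and the rest.\<close>
    have "card S \<le> card E" using S(1) finite_E by (rule card_mono[rotated])
    then have "S \<subseteq> Z"
      using run_forced_subset[where \<pi> = \<pi> and i = i and n = "card S" and m = "card E - card S",
          OF valid[OF \<phi>] _ finS] first Z by auto
    moreover from this have "card (Z - S) \<le> k - l"
      using card S(2) finS by (simp add: card_Diff_subset)
    ultimately show "S \<subseteq> Z \<and> card (Z - S) \<le> r t" by (simp add: rt)
  next
    fix h \<phi> T assume h: "h \<in> histories A t" and \<phi>: "\<phi> \<in> set_pmf p" and T: "T \<subseteq> E" "card T \<le> r t"
    show "(\<Sum>e\<in>T. marginal e (chosen h) \<phi>) \<le> (\<Sum>x\<in>V i \<phi> h. ext_marginal x (chosen h) \<phi>)"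
      using top_set_extended_items(2)[OF finite_E top_V[OF i \<phi> h t] _ _ T(1)] T(2) by (simp add: rt)
  qed
qed

lemma greedy_ratio:
  assumes S: "S \<subseteq> E" "card S = l" and \<pi>: "\<pi> \<in> Omega_policies E p G S k"
  shows "1 / 32 * f_avg p f M (selected E \<pi>) \<le> f_avg p f M (greedy_selected U1 U2 l k)"
proof -
  define F where "F t = (\<Sum>i\<in>M. greedy_task.utility_after E p f i (V i) k t)" for t
  define Q where "Q t = (\<Sum>i\<in>M. greedy_task.joint_utility E p f i (V i) k (\<pi> i) t)" for t
  have gain_eq: "gain_sum t = real (r t) * (F (Suc t) - F t)" if "t < k" for t
    unfolding F_def sum_subtractf[symmetric] sum_distrib_left
    by (intro sum.cong refl)
      (use that greedy_task.utility_after_Suc[OF greedy_task that] greedy_task.r_pos[OF greedy_task that]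
       in simp)
  have Q_Suc: "(1 - 1 / real (r t)) * Q t \<le> Q (Suc t)" if "t < k" for t
    unfolding Q_def sum_distrib_left
    by (intro sum_mono greedy_task.joint_utility_Suc[OF greedy_task that])
  have Q0: "0 \<le> Q 0"
    unfolding Q_def by (intro sum_nonneg greedy_task.joint_utility_nonneg[OF greedy_task])
  have "1 / 16 * Q 0 \<le> 2 * F k"
  proof (rule half_bound[where g = gain_sum and B = "optimal_marginal_sum S" and Q = Q and l = l])
    show "0 \<le> F 0"
      unfolding F_def by (intro sum_nonneg greedy_task.utility_after_nonneg[OF greedy_task])
    fix t
    show "1 / 16 * Q 0 \<le> Q t" if "l \<le> t" "t < k"
    proof (rule iterated_factor_bound[where Q = Q, OF l k Q0 _ _ that])
      show "(1 - 1 / real l) * Q s \<le> Q (Suc s)" if "s < l" for s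
        using Q_Suc[of s] that k by (simp add: r_def)
      show "(1 - 1 / real (k - l)) * Q s \<le> Q (Suc s)" if "l \<le> s" "s < k" for s
      proof -
        have "r s = k - l" using that by (simp add: r_def)
        then show ?thesis using Q_Suc[OF that(2)] by (simp only:)
      qed
    qed
    show "Q t \<le> F t + optimal_marginal_sum S t + gain_sum t" if "l \<le> t" "t < k"
      unfolding Q_def F_def by (rule joint_sum_le[OF that S \<pi>])
    show "gain_sum t = real l * (F (Suc t) - F t)" if "t < l"
      using gain_eq[of t] that k by (simp add: r_def)
    show "gain_sum t = real (k - l) * (F (Suc t) - F t)" if "l \<le> t" "t < k"
      using gain_eq[of t] that by (simp add: r_def)
    show "0 \<le> gain_sum t" if "t < k" by (rule gain_sum_nonneg[OF that])
    show "optimal_marginal_sum S (Suc t) \<le> optimal_marginal_sum S t" if "t < k"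
      by (rule optimal_marginal_sum_Suc[OF that S(1)])
    show "optimal_marginal_sum S t \<le> gain_sum t" if "t < l" by (rule optimal_marginal_sum_le_gain_sum[OF that S])
  qed (use l k in linarith)+
  moreover have "Q 0 = (\<Sum>i\<in>M. f_avg_task p f (selected E \<pi>) i)"
    unfolding Q_def by (intro sum.cong refl policy_value[symmetric]) (use \<pi> in \<open>auto simp: Omega_policies_def\<close>)
  moreover have "F k = (\<Sum>i\<in>M. f_avg_task p f (greedy_selected U1 U2 l k) i)"
    unfolding F_def by (intro sum.cong refl greedy_value[symmetric])
  ultimately have "1 / 32 * (\<Sum>i\<in>M. f_avg_task p f (selected E \<pi>) i)
      \<le> (\<Sum>i\<in>M. f_avg_task p f (greedy_selected U1 U2 l k) i)" by simp
  from mult_left_mono[OF this, of "1 / real (card M)"] show ?thesis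
    unfolding f_avg_def by (simp only: mult.left_commute zero_le_divide_1_iff of_nat_0_le_iff)
qed

end

theorem corollary1:
  fixes E :: "'e set" and St :: "'s set" and p :: "('e \<Rightarrow> 's) pmf"
    and G M :: "'g set" and f :: "'g \<Rightarrow> 'e set \<Rightarrow> ('e \<Rightarrow> 's) \<Rightarrow> real"
    and l k :: nat
    and U1 :: "('e + nat) list \<Rightarrow> ('e + nat) set"
    and U2 :: "'g \<Rightarrow> ('e + nat) list \<Rightarrow> ('e \<rightharpoonup> 's) \<Rightarrow> ('e + nat) set"
    and \<pi>\<^sub>o :: "('g, 'e, 's) policy"
  assumes "finite E"
    and "set_pmf p \<subseteq> E \<rightarrow>\<^sub>E St"
    and "M \<subseteq> G" and "finite M" and "M \<noteq> {}"
    and "\<And>i Y \<phi>. i \<in> G \<Longrightarrow> Y \<subseteq> E \<Longrightarrow> \<phi> \<in> E \<rightarrow>\<^sub>E St \<Longrightarrow> 0 \<le> f i Y \<phi>"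
    and "\<And>i Y. i \<in> G \<Longrightarrow> Y \<subseteq> E \<Longrightarrow> integrable (measure_pmf p) (f i Y)"
    and "l > 1" and "k - l > 1"
    and "\<And>i. i \<in> M \<Longrightarrow> adaptive_submodular E p f i"
    and "initial_rule E p f M l k U1"
    and "execution_rule E p f G l k U2"
    and "optimal_policy E p f G M l k \<pi>\<^sub>o"
  shows "f_avg p f M (greedy_selected U1 U2 l k) \<ge> 1 / 32 * f_avg p f M (selected E \<pi>\<^sub>o)"
proof -
  have task: "adaptive_task E p f i" if "i \<in> M" for i
  proof
    have "i \<in> G" using that \<open>M \<subseteq> G\<close> by auto
    then show "0 \<le> f i Y \<phi>" if "Y \<subseteq> E" "\<phi> \<in> set_pmf p" for Y \<phi>
      using assms(2,6) that by auto
    show "integrable (measure_pmf p) (f i Y)" if "Y \<subseteq> E" for Y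
      using assms(7) \<open>i \<in> G\<close> that by auto
  qed (use assms that in auto)
  interpret two_phase E p f G M l k U1 U2
    by (intro two_phase.intro task assms(3-5,8,9,11,12))
  from assms(13) obtain S where "S \<subseteq> E" "card S = l" "\<pi>\<^sub>o \<in> Omega_policies E p G S k"
    unfolding optimal_policy_def by auto
  then show ?thesis by (rule greedy_ratio)
qed

end
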